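(* Let $p$ be an odd prime, let $F$ be a field of characteristic $p$, and let $n\in\mathbb{N}_0$. Let $(\alpha|\beta)$ and $(\sigma|\tau)$ be pairs of partitions with $|\alpha|+|\beta|=n=|\sigma|+|\tau|$. Then $M(\alpha|\beta)\cong M(\sigma|\tau)$ as $F\mathfrak{S}_n$-modules if and only if $\alpha=\rho\#(1^a)$, $\sigma=\rho\#(1^b)$, $\beta=\zeta\#(1^c)$ and $\tau=\zeta\#(1^d)$ for some non-negative integers $a,b,c,d$ and partitions $\rho,\zeta$.
   Context: For partitions $\alpha,\beta$ with $|\alpha|+|\beta|=n$, the signed Young permutation module is $M(\alpha|\beta)=\mathrm{Ind}_{\mathfrak{S}_\alpha\times\mathfrak{S}_\beta}^{\mathfrak{S}_n}(F(\alpha)\boxtimes\mathrm{sgn}(\beta))$, where $\mathfrak{S}_\alpha$ and $\mathfrak{S}_\beta$ are the standard Young subgroups of $\mathfrak S_{|\alpha|}$ and $\mathfrak S_{|\beta|}$, $F(\alpha)$ is the trivial $F\mathfrak{S}_\alpha$-module and $\mathrm{sgn}(\beta)$ is the restriction to $\mathfrak{S}_\beta$ of the sign module. $\rho\#(1^a)$ denotes the concatenation of $\rho$ with $a$ parts equal to $1$ (i.e. $a$ parts equal to $1$ appended to $\rho$). Partitions may be empty. *)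

theory Defs
  imports
    "HOL-Computational_Algebra.Primes"
    "HOL-Algebra.Sym_Groups"
    "HOL-Algebra.AbelCoset"
    "HOL-Algebra.Module"
    "HOL-Algebra.Generated_Groups"
    "HOL-Combinatorics.Orbits"
begin

text \<open>
  A module over the group algebra \<open>FG\<close> is an \<open>F\<close>-vector space (\<open>F\<close> being the type \<open>'f\<close>) with a linear
  action of \<open>G\<close>. The fields \<open>mult\<close> and \<open>one\<close>, which the record \<open>module\<close> inherits from \<open>ring\<close>, play no
  role.
\<close>

record ('f, 'v, 'g) group_module = "('f, 'v) module" +
  act :: "'g \<Rightarrow> 'v \<Rightarrow> 'v"

definition group_module_iso ::
    "('g, 'm) monoid_scheme \<Rightarrow> ('f, 'v, 'g) group_module \<Rightarrow> ('f, 'w, 'g) group_module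
      \<Rightarrow> ('v \<Rightarrow> 'w) set" where
  "group_module_iso G M N =
    {\<phi> \<in> iso (add_monoid M) (add_monoid N).
       (\<forall>c. \<forall>x\<in>carrier M. \<phi> (c \<odot>\<^bsub>M\<^esub> x) = c \<odot>\<^bsub>N\<^esub> \<phi> x) \<and>
       (\<forall>g\<in>carrier G. \<forall>x\<in>carrier M. \<phi> (act M g x) = act N g (\<phi> x))}"

definition group_module_isomorphic ::
    "('g, 'm) monoid_scheme \<Rightarrow> ('f, 'v, 'g) group_module \<Rightarrow> ('f, 'w, 'g) group_module \<Rightarrow> bool" where
  "group_module_isomorphic G M N \<longleftrightarrow> group_module_iso G M N \<noteq> {}"

text \<open>The quotient of \<open>M\<close> by a submodule \<open>N\<close>. The union in \<open>smult\<close> is the coset of \<open>c \<odot> x\<close> for any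
  representative \<open>x\<close> of \<open>X\<close>; likewise for \<open>act\<close>.\<close>

definition quotient_module ::
    "('f, 'v, 'g) group_module \<Rightarrow> 'v set \<Rightarrow> ('f, 'v set, 'g) group_module" where
  "quotient_module M N =
    \<lparr>carrier = a_rcosets\<^bsub>M\<^esub> N, mult = undefined, one = undefined,
     zero = N, add = (<+>\<^bsub>M\<^esub>),
     smult = (\<lambda>c X. \<Union>x\<in>X. N +>\<^bsub>M\<^esub> (c \<odot>\<^bsub>M\<^esub> x)),
     act = (\<lambda>g X. \<Union>x\<in>X. N +>\<^bsub>M\<^esub> act M g x)\<rparr>"

text \<open>
  For a finite group \<open>G\<close>, the module \<open>FG \<otimes>\<^sub>F V\<close>, on which \<open>G\<close> acts by left multiplication on \<open>FG\<close>:
  the function \<open>f\<close> stands for \<open>\<Sum>\<^sub>g g \<otimes> f g\<close>.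
\<close>

definition free_module ::
    "('g, 'm) monoid_scheme \<Rightarrow> ('f, 'v, 'g) group_module \<Rightarrow> ('f, 'g \<Rightarrow> 'v, 'g) group_module" where
  "free_module G V =
    \<lparr>carrier = carrier G \<rightarrow>\<^sub>E carrier V, mult = undefined, one = undefined,
     zero = (\<lambda>g\<in>carrier G. \<zero>\<^bsub>V\<^esub>),
     add = (\<lambda>f f'. \<lambda>g\<in>carrier G. f g \<oplus>\<^bsub>V\<^esub> f' g),
     smult = (\<lambda>c f. \<lambda>g\<in>carrier G. c \<odot>\<^bsub>V\<^esub> f g),
     act = (\<lambda>x f. \<lambda>g\<in>carrier G. f (inv\<^bsub>G\<^esub> x \<otimes>\<^bsub>G\<^esub> g))\<rparr>"

definition pure_tensor ::
    "('g, 'm) monoid_scheme \<Rightarrow> ('f, 'v, 'g) group_module \<Rightarrow> 'g \<Rightarrow> 'v \<Rightarrow> 'g \<Rightarrow> 'v" where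
  "pure_tensor G V g v = (\<lambda>x\<in>carrier G. if x = g then v else \<zero>\<^bsub>V\<^esub>)"

text \<open>
  \<open>Ind\<^sub>H\<^sup>G V = FG \<otimes>\<^bsub>FH\<^esub> V\<close> for a finite group \<open>G\<close>, a subgroup \<open>H\<close> and an \<open>FH\<close>-module \<open>V\<close>. The
  relations below are closed under scalars and under the action of \<open>G\<close>, so the additive subgroup
  they generate is a submodule.
\<close>

definition tensor_relations ::
    "('g, 'm) monoid_scheme \<Rightarrow> 'g set \<Rightarrow> ('f, 'v, 'g) group_module \<Rightarrow> ('g \<Rightarrow> 'v) set" where
  "tensor_relations G H V =
    {pure_tensor G V (g \<otimes>\<^bsub>G\<^esub> h) v \<ominus>\<^bsub>free_module G V\<^esub> pure_tensor G V g (act V h v) | g h v.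
       g \<in> carrier G \<and> h \<in> H \<and> v \<in> carrier V}"

definition induced_module ::
    "('g, 'm) monoid_scheme \<Rightarrow> 'g set \<Rightarrow> ('f, 'v, 'g) group_module
      \<Rightarrow> ('f, ('g \<Rightarrow> 'v) set, 'g) group_module" where
  "induced_module G H V =
    quotient_module (free_module G V)
      (generate (add_monoid (free_module G V)) (tensor_relations G H V))"

definition line_module :: "('g \<Rightarrow> 'f::field) \<Rightarrow> ('f, 'f, 'g) group_module" where
  "line_module \<chi> =
    \<lparr>carrier = UNIV, mult = undefined, one = undefined, zero = 0, add = (+),
     smult = (*), act = (\<lambda>h v. \<chi> h * v)\<rparr>"

definition is_partition :: "nat list \<Rightarrow> bool" where
  "is_partition \<mu> \<longleftrightarrow> sorted_wrt (\<ge>) \<mu> \<and> 0 \<notin> set \<mu>"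

text \<open>The standard Young subgroup of the symmetric group on \<open>{k+1..k+m}\<close>, where \<open>m\<close> is the size
  of \<open>\<mu>\<close>; its elements fix all numbers outside this interval.\<close>

definition young_block :: "nat \<Rightarrow> nat list \<Rightarrow> nat \<Rightarrow> nat set" where
  "young_block k \<mu> i = {k + sum_list (take i \<mu>)<..k + sum_list (take (Suc i) \<mu>)}"

definition young_subgroup :: "nat \<Rightarrow> nat list \<Rightarrow> (nat \<Rightarrow> nat) set" where
  "young_subgroup k \<mu> =
    {\<pi>. \<pi> permutes {k<..k + sum_list \<mu>} \<and>
        (\<forall>i<length \<mu>. \<pi> ` young_block k \<mu> i = young_block k \<mu> i)}"

text \<open>
  The outer tensor product of \<open>F(\<alpha>)\<close> and \<open>sgn(\<beta>)\<close>: both factors are \<open>F\<close> as a vector space, and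
  \<open>F \<otimes>\<^sub>F F = F\<close>. An element \<open>\<pi>\<close> of \<open>\<SS>\<^sub>\<alpha> \<times> \<SS>\<^sub>\<beta>\<close> acts as the scalar \<open>1 \<cdot> sgn \<pi>'\<close>, where \<open>\<pi>'\<close> is its
  component in \<open>\<SS>\<^sub>\<beta>\<close>, that is, its restriction to the points of \<open>\<beta>\<close>.
\<close>

definition trivial_sign_module ::
    "'f::field itself \<Rightarrow> nat list \<Rightarrow> nat list \<Rightarrow> ('f, 'f, nat \<Rightarrow> nat) group_module" where
  "trivial_sign_module _ \<alpha> \<beta> =
    line_module (\<lambda>\<pi>. of_int (sign (perm_restrict \<pi> {sum_list \<alpha><..sum_list \<alpha> + sum_list \<beta>})))"

definition signed_young_module ::
    "'f::field itself \<Rightarrow> nat list \<Rightarrow> nat list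
      \<Rightarrow> ('f, ((nat \<Rightarrow> nat) \<Rightarrow> 'f) set, nat \<Rightarrow> nat) group_module" where
  "signed_young_module F \<alpha> \<beta> =
    (let G = sym_group (sum_list \<alpha> + sum_list \<beta>)
     in induced_module G
          (young_subgroup 0 \<alpha> <#>\<^bsub>G\<^esub> young_subgroup (sum_list \<alpha>) \<beta>)
          (trivial_sign_module F \<alpha> \<beta>))"

end

theory Submission
  imports Defs "HOL-Library.Multiset" "HOL-Computational_Algebra.Polynomial"
begin

text \<open>
Let \<open>X\<^sub>N\<close> be the set of colourings of \<open>{1..n}\<close> with \<open>N\<close> colours. The symmetric group permutes the
positions, so the functions \<open>X\<^sub>N \<rightarrow> F\<close> form the module \<open>V\<^sup>\<otimes>\<^sup>n\<close> with \<open>dim V = N\<close>. The dimension of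
\<open>Hom(M(\<alpha>|\<beta>), V\<^sup>\<otimes>\<^sup>n)\<close> is an isomorphism invariant of \<open>M(\<alpha>|\<beta>)\<close>, for each \<open>N\<close>. By Frobenius
reciprocity this space consists of the functions \<open>f\<close> with \<open>f (c \<circ> h) = \<plusminus> f c\<close> for all \<open>h\<close> in the
Young subgroup of \<open>(\<alpha>|\<beta>)\<close>, where the sign is that of the component of \<open>h\<close> at \<open>\<beta>\<close>. Such a function
vanishes on each colouring with a repeated colour in a block of \<open>\<beta>\<close>, because \<open>2 \<noteq> 0\<close> in \<open>F\<close>, and
its values on representatives of the other orbits are arbitrary. An orbit is given by the multiset of
colours in each block, so the dimension is
\<open>\<Prod>\<^sub>i (\<alpha>\<^sub>i + N - 1 choose \<alpha>\<^sub>i) \<cdot> \<Prod>\<^sub>j (N choose \<beta>\<^sub>j)\<close>.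

As a polynomial in \<open>N\<close>, a factor of the first kind has the simple roots \<open>0, -1, \<dots>, -(\<alpha>\<^sub>i - 1)\<close> and one
of the second kind the simple roots \<open>0, 1, \<dots>, \<beta>\<^sub>j - 1\<close>. For \<open>m \<ge> 1\<close> the multiplicity of the root
\<open>-m\<close> is therefore the number of parts of \<open>\<alpha>\<close> above \<open>m\<close>, and that of the root \<open>m\<close> is the number of
parts of \<open>\<beta>\<close> above \<open>m\<close>. Hence the module determines all parts of \<open>\<alpha>\<close> and of \<open>\<beta>\<close> that exceed \<open>1\<close>
(\<open>colour_count_determines_long_parts\<close>).

The invariance is proved with coordinates. An isomorphism is described by an element \<open>u\<close> of the group
algebra, the image of the generator of the source. Right convolution by \<open>u\<close> carries the functions
that belong to the target injectively to those that belong to the source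
(\<open>induced_line_module_iso_imp_convolution\<close>). If the target had more orbits than the source, then a
homogeneous linear system with more unknowns than equations would give a nonzero function in the kernel
(\<open>colour_types_card_mono\<close>).

Conversely, a part \<open>1\<close> contributes a trivial factor to the Young subgroup, whether it belongs to
\<open>\<alpha>\<close> or to \<open>\<beta>\<close>. If two pairs differ only in the placement of parts \<open>1\<close>, then a permutation conjugates
one Young subgroup to the other and carries one sign character to the other, and modules induced from
conjugate characters are isomorphic (\<open>conjugate_induced_line_modules_isomorphic\<close>).
\<close>

section \<open>Homogeneous linear systems\<close>

text \<open>
  Gaussian elimination: an equation in which some unknown \<open>a0\<close> has a nonzero coefficient is used to
  remove \<open>a0\<close> from the other equations.
\<close>

lemma homogeneous_system_nontrivial_solution:
  fixes m :: "'a \<Rightarrow> 'b \<Rightarrow> 'f::field"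
  assumes "finite B" "finite A" "card B < card A"
  obtains x where "\<exists>a\<in>A. x a \<noteq> 0" "\<forall>b\<in>B. (\<Sum>a\<in>A. x a * m a b) = 0"
proof -
  have "\<exists>x. (\<exists>a\<in>A. x a \<noteq> 0) \<and> (\<forall>b\<in>B. (\<Sum>a\<in>A. x a * m a b) = 0)"
    using assms
  proof (induction B arbitrary: A m rule: finite_induct)
    case empty
    then obtain a where "a \<in> A" by (metis all_not_in_conv card.empty less_irrefl)
    then show ?case by (intro exI[of _ "\<lambda>_. 1"]) auto
  next
    case (insert b B)
    show ?case
    proof (cases "\<forall>a\<in>A. m a b = 0")
      case True
      have "card B < card A" using insert by simp
      from insert.IH[OF insert.prems(1) this, of m] True show ?thesis by auto
    next
      case False
      then obtain a0 where a0: "a0 \<in> A" "m a0 b \<noteq> 0" by blast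
      let ?A = "A - {a0}"
      define m' where "m' a b' = m a b' - m a b / m a0 b * m a0 b'" for a b'
      have "card B < card ?A" using insert a0 by simp
      from insert.IH[OF _ this, of m'] insert.prems(1)
      obtain x where x: "\<exists>a\<in>?A. x a \<noteq> 0" "\<forall>b\<in>B. (\<Sum>a\<in>?A. x a * m' a b) = 0" by auto
      define s where "s = (\<Sum>a\<in>?A. x a * m a b) / m a0 b"
      define y where "y = x(a0 := - s)"
      have split: "(\<Sum>a\<in>A. y a * m a b') = - s * m a0 b' + (\<Sum>a\<in>?A. x a * m a b')" for b'
        using a0 insert.prems(1) by (simp add: sum.remove y_def)
      have "(\<Sum>a\<in>A. y a * m a b) = 0"
        unfolding split using a0 by (simp add: s_def)
      moreover have "(\<Sum>a\<in>A. y a * m a b') = 0" if "b' \<in> B" for b'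
      proof -
        have "0 = (\<Sum>a\<in>?A. x a * m' a b')" using x that by simp
        also have "\<dots> = (\<Sum>a\<in>?A. x a * m a b') - s * m a0 b'"
          by (simp add: m'_def s_def algebra_simps sum_subtractf sum_distrib_left sum_divide_distrib
                sum_distrib_right)
        finally show ?thesis unfolding split by simp
      qed
      moreover have "\<exists>a\<in>A. y a \<noteq> 0" using x(1) by (auto simp: y_def)
      ultimately show ?thesis by blast
    qed
  qed
  then show thesis using that by blast
qed

section \<open>The dimension polynomial\<close>

text \<open>
  A multiset over \<open>{..<N}\<close> is the list of its \<open>N\<close> multiplicities.
\<close>

lemma card_multisets:
  "card {M. set_mset M \<subseteq> {..<N::nat} \<and> size M = k} = (k + N - 1) choose k"
proof -
  have "bij_betw (\<lambda>M. map (count M) [0..<N])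
      {M. set_mset M \<subseteq> {..<N} \<and> size M = k} {l::nat list. length l = N \<and> sum_list l = k}"
  proof (rule bij_betw_byWitness[where f' = "\<lambda>l. \<Sum>i<N. replicate_mset (l ! i) i"])
    have sz: "size M = (\<Sum>i<N. count M i)" if "set_mset M \<subseteq> {..<N}" for M
      using that by (simp add: size_multiset_overloaded_eq sum.mono_neutral_left
          not_in_iff subset_iff)
    have cnt: "count (\<Sum>i<N. replicate_mset (l ! i) i) j = (if j < N then l ! j else 0)" for l j
      by (simp add: count_sum if_distrib cong: if_cong)
    show "\<forall>M\<in>{M. set_mset M \<subseteq> {..<N} \<and> size M = k}.
        (\<Sum>i<N. replicate_mset (map (count M) [0..<N] ! i) i) = M"
    proof (intro ballI multiset_eqI)
      fix M x assume M: "M \<in> {M. set_mset M \<subseteq> {..<N} \<and> size M = k}"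
      then have "count M x = 0" if "\<not> x < N" using that by (auto simp: not_in_iff[symmetric])
      then show "count (\<Sum>i<N. replicate_mset (map (count M) [0..<N] ! i) i) x = count M x"
        unfolding cnt by simp
    qed
    show "\<forall>l\<in>{l. length l = N \<and> sum_list l = k}.
        map (count (\<Sum>i<N. replicate_mset (l ! i) i)) [0..<N] = l"
    proof (intro ballI nth_equalityI)
      fix l i assume l: "l \<in> {l. length l = N \<and> sum_list l = k}"
        and "i < length (map (count (\<Sum>i<N. replicate_mset (l ! i) i)) [0..<N])"
      then show "map (count (\<Sum>i<N. replicate_mset (l ! i) i)) [0..<N] ! i = l ! i"
        by (simp only: length_map length_upt nth_map nth_upt cnt) simp
    qed simp
    show "(\<lambda>M. map (count M) [0..<N]) ` {M. set_mset M \<subseteq> {..<N} \<and> size M = k}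
        \<subseteq> {l. length l = N \<and> sum_list l = k}"
      by (auto simp: sz sum_list_sum_nth atLeast0LessThan)
    have sub: "set_mset (\<Sum>i<N. replicate_mset (l ! i) i) \<subseteq> {..<N}" for l
      by (auto simp flip: count_greater_zero_iff simp: cnt split: if_splits)
    show "(\<lambda>l. \<Sum>i<N. replicate_mset (l ! i) i) ` {l. length l = N \<and> sum_list l = k}
        \<subseteq> {M. set_mset M \<subseteq> {..<N} \<and> size M = k}"
      using sub by (auto simp: sum_list_sum_nth atLeast0LessThan)
  qed
  then show ?thesis by (simp add: bij_betw_same_card card_length_sum_list)
qed

lemma card_submsets_of_distinct:
  "card {M. set_mset M \<subseteq> {..<N::nat} \<and> size M = k \<and> (\<forall>x. count M x \<le> 1)} = N choose k"
proof -
  have "bij_betw mset_set {S. S \<subseteq> {..<N} \<and> card S = k}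
      {M. set_mset M \<subseteq> {..<N} \<and> size M = k \<and> (\<forall>x. count M x \<le> 1)}"
  proof (rule bij_betw_byWitness[where f' = set_mset])
    have eq: "mset_set (set_mset M) = M" if "\<forall>x. count M x \<le> 1" for M :: "nat multiset"
    proof (rule multiset_eqI)
      fix x show "count (mset_set (set_mset M)) x = count M x"
        using that[rule_format, of x] by (cases "x \<in># M") (auto simp: count_mset_set' le_Suc_eq count_eq_zero_iff)
    qed
    show "\<forall>S\<in>{S. S \<subseteq> {..<N} \<and> card S = k}. set_mset (mset_set S) = S"
      by (auto dest: finite_subset)
    show "\<forall>M\<in>{M. set_mset M \<subseteq> {..<N} \<and> size M = k \<and> (\<forall>x. count M x \<le> 1)}.
        mset_set (set_mset M) = M" by (simp add: eq)
    show "mset_set ` {S. S \<subseteq> {..<N} \<and> card S = k}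
        \<subseteq> {M. set_mset M \<subseteq> {..<N} \<and> size M = k \<and> (\<forall>x. count M x \<le> 1)}"
    proof clarify
      fix S assume "S \<subseteq> {..<N}"
      moreover from this have "finite S" by (rule finite_subset) simp
      ultimately show "set_mset (mset_set S) \<subseteq> {..<N} \<and> size (mset_set S) = card S
          \<and> (\<forall>x. count (mset_set S) x \<le> 1)" by (simp add: count_mset_set')
    qed
    show "set_mset ` {M. set_mset M \<subseteq> {..<N} \<and> size M = k \<and> (\<forall>x. count M x \<le> 1)}
        \<subseteq> {S. S \<subseteq> {..<N} \<and> card S = k}"
      using eq by (auto simp flip: size_mset_set)
  qed
  then have "card {M. set_mset M \<subseteq> {..<N} \<and> size M = k \<and> (\<forall>x. count M x \<le> 1)}
      = card {S. S \<subseteq> {..<N} \<and> card S = k}" by (simp add: bij_betw_same_card)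
  then show ?thesis by (simp add: n_subsets)
qed

text \<open>
  The falling factorial of degree \<open>k\<close> for \<open>e = 1\<close>, and the rising factorial for \<open>e = -1\<close>.
\<close>

definition factorial_poly :: "int \<Rightarrow> nat \<Rightarrow> real poly" where
  "factorial_poly e k = (\<Prod>j<k. [: - of_int e * of_nat j, 1:])"

lemma factorial_poly_nonzero: "factorial_poly e k \<noteq> 0"
  by (simp add: factorial_poly_def)

lemma poly_rising_factorial: "poly (factorial_poly (-1) k) (real N) = fact k * real ((k + N - 1) choose k)"
proof -
  have "poly (factorial_poly (-1) k) (real N) = pochhammer (real N) k"
    by (simp add: factorial_poly_def poly_prod pochhammer_prod add.commute atLeast0LessThan)
  also have "\<dots> = fact k * real ((k + N - 1) choose k)"
  proof (cases "k + N")
    case 0 then show ?thesis by simp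
  next
    case (Suc m)
    then have "real (k + N - 1) = real N + real k - 1" by (simp add: of_nat_diff)
    then show ?thesis
      using gbinomial_pochhammer'[of "real (k + N - 1)" k] 
      by (simp add: binomial_gbinomial)
  qed
  finally show ?thesis .
qed

lemma poly_falling_factorial: "poly (factorial_poly 1 k) (real N) = fact k * real (N choose k)"
proof -
  have "poly (factorial_poly 1 k) (real N) = (\<Prod>j<k. real N - real j)"
    by (simp add: factorial_poly_def poly_prod)
  then show ?thesis
    by (simp add: binomial_gbinomial gbinomial_prod_rev atLeast0LessThan)
qed

lemma order_linear: "Polynomial.order r [: - s, 1 :: real:] = (if r = s then 1 else 0)"
proof (cases "r = s")
  case True then show ?thesis using order_power_n_n[of s 1] by simp
next
  case False then show ?thesis by (simp add: order_0I)
qed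

lemma order_factorial_poly:
  "Polynomial.order r (factorial_poly e k) = card {j. j < k \<and> real_of_int e * real j = r}"
proof (induction k)
  case 0 then show ?case by (simp add: factorial_poly_def)
next
  case (Suc k)
  have eq: "factorial_poly e (Suc k) = factorial_poly e k * [: - of_int e * of_nat k, 1:]"
    by (simp add: factorial_poly_def)
  have "{j. j < Suc k \<and> real_of_int e * real j = r} =
      (if r = of_int e * of_nat k then insert k {j. j < k \<and> real_of_int e * real j = r}
       else {j. j < k \<and> real_of_int e * real j = r})"
    by (auto simp: less_Suc_eq)
  moreover have "factorial_poly e (Suc k) \<noteq> 0" by (rule factorial_poly_nonzero)
  ultimately show ?case
    using order_mult[of "factorial_poly e k" "[: - (of_int e * of_nat k), 1:]" r]
    by (simp only: eq mult_minus_left order_linear Suc) (simp del: mult_pCons_right)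
qed

text \<open>
  The value at \<open>N\<close> is \<open>\<Prod>\<^sub>i \<alpha>\<^sub>i! \<cdot> \<Prod>\<^sub>j \<beta>\<^sub>j!\<close> times the number \<open>colour_count \<alpha> \<beta> N\<close> below.
\<close>

definition dimension_poly :: "nat list \<Rightarrow> nat list \<Rightarrow> real poly" where
  "dimension_poly \<alpha> \<beta> =
     (\<Prod>k\<leftarrow>\<alpha>. factorial_poly (-1) k) * (\<Prod>k\<leftarrow>\<beta>. factorial_poly 1 k)"

lemma order_prod_list:
  assumes "\<And>k. f k \<noteq> 0"
  shows "Polynomial.order r (\<Prod>k\<leftarrow>ks. f k) = (\<Sum>k\<leftarrow>ks. Polynomial.order r (f k :: 'a::idom poly))"
proof (induction ks)
  case (Cons k ks)
  have "(\<Prod>k\<leftarrow>ks. f k) \<noteq> 0" using assms by (auto simp: prod_list_zero_iff)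
  with Cons assms show ?case by (simp add: order_mult)
qed simp

lemma order_dimension_poly:
  "Polynomial.order r (dimension_poly \<alpha> \<beta>) =
     (\<Sum>k\<leftarrow>\<alpha>. card {j. j < k \<and> - real j = r}) + (\<Sum>k\<leftarrow>\<beta>. card {j. j < k \<and> real j = r})"
proof -
  have "(\<Prod>k\<leftarrow>\<alpha>. factorial_poly (-1) k) * (\<Prod>k\<leftarrow>\<beta>. factorial_poly 1 k) \<noteq> 0"
    using factorial_poly_nonzero by (auto simp: prod_list_zero_iff)
  then show ?thesis
    unfolding dimension_poly_def
    by (simp add: order_mult order_prod_list factorial_poly_nonzero order_factorial_poly)
qed

lemma sum_list_indicator: "(\<Sum>k\<leftarrow>ks. if P k then 1 else 0 :: nat) = length (filter P ks)"
  by (induction ks) auto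

text \<open>
  The bound \<open>m \<ge> 1\<close> separates \<open>\<alpha>\<close> from \<open>\<beta>\<close>: the root \<open>0\<close> is shared by all factors, a negative root
  comes only from \<open>\<alpha>\<close> and a positive one only from \<open>\<beta>\<close>.
\<close>

lemma order_dimension_poly_negative:
  assumes "m \<ge> 1"
  shows "Polynomial.order (- real m) (dimension_poly \<alpha> \<beta>) = length (filter (\<lambda>k. k > m) \<alpha>)"
proof -
  have 1: "card {j. j < k \<and> - real j = - real m} = (if k > m then 1 else 0)" for k
  proof -
    have "{j. j < k \<and> - real j = - real m} = (if k > m then {m} else {})" by auto
    then show ?thesis by simp
  qed
  have 2: "card {j. j < k \<and> real j = - real m} = 0" for k using assms by (auto simp: card_eq_0_iff)
  show ?thesis unfolding order_dimension_poly 1 2 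
    sum_list_indicator by simp
qed

lemma order_dimension_poly_positive:
  assumes "m \<ge> 1"
  shows "Polynomial.order (real m) (dimension_poly \<alpha> \<beta>) = length (filter (\<lambda>k. k > m) \<beta>)"
proof -
  have 1: "card {j. j < k \<and> real j = real m} = (if k > m then 1 else 0)" for k
  proof -
    have "{j. j < k \<and> real j = real m} = (if k > m then {m} else {})" by auto
    then show ?thesis by simp
  qed
  have 2: "card {j. j < k \<and> - real j = real m} = 0" for k using assms by (auto simp: card_eq_0_iff)
  show ?thesis unfolding order_dimension_poly 1 2 
    sum_list_indicator by simp
qed

text \<open>
  The dimension of the tensor product of the symmetric powers of degrees \<open>\<alpha>\<close> and the exterior powers
  of degrees \<open>\<beta>\<close> of an \<open>N\<close>-dimensional space.
\<close>

definition colour_count :: "nat list \<Rightarrow> nat list \<Rightarrow> nat \<Rightarrow> nat" where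
  "colour_count \<alpha> \<beta> N = (\<Prod>k\<leftarrow>\<alpha>. (k + N - 1) choose k) * (\<Prod>k\<leftarrow>\<beta>. N choose k)"

lemma poly_prod_list: "poly (\<Prod>k\<leftarrow>ks. f k) x = (\<Prod>k\<leftarrow>ks. poly (f k) x)"
  by (induction ks) auto

lemma of_nat_prod_list: "of_nat (\<Prod>k\<leftarrow>ks. f k) = (\<Prod>k\<leftarrow>ks. of_nat (f k) :: 'a::comm_semiring_1)"
  by (induction ks) auto

lemma prod_list_mult: "(\<Prod>k\<leftarrow>ks. f k * g k :: 'a::comm_monoid_mult) = (\<Prod>k\<leftarrow>ks. f k) * (\<Prod>k\<leftarrow>ks. g k)"
  by (induction ks) (auto simp: ac_simps)

lemma poly_dimension_poly:
  "poly (dimension_poly \<alpha> \<beta>) (real N) =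
     (\<Prod>k\<leftarrow>\<alpha>. fact k) * (\<Prod>k\<leftarrow>\<beta>. fact k) * real (colour_count \<alpha> \<beta> N)"
  by (simp add: dimension_poly_def poly_prod_list poly_rising_factorial poly_falling_factorial colour_count_def
      of_nat_prod_list prod_list_mult)

text \<open>
  The two dimension polynomials agree, up to constants, at infinitely many arguments, so they have the
  same roots with the same multiplicities.
\<close>

lemma colour_count_determines_long_parts:
  assumes "\<And>N. colour_count \<alpha> \<beta> N = colour_count \<sigma> \<tau> N" "m \<ge> 1"
  shows "length (filter (\<lambda>k. k > m) \<alpha>) = length (filter (\<lambda>k. k > m) \<sigma>)"
    and "length (filter (\<lambda>k. k > m) \<beta>) = length (filter (\<lambda>k. k > m) \<tau>)"
proof -
  define c where "c \<alpha> \<beta> = (\<Prod>k\<leftarrow>\<alpha>. fact k) * (\<Prod>k\<leftarrow>\<beta>. fact k :: real)" for \<alpha> \<beta>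
  have c: "c \<alpha> \<beta> \<noteq> 0" for \<alpha> \<beta> by (auto simp: c_def prod_list_zero_iff)
  let ?p = "smult (c \<sigma> \<tau>) (dimension_poly \<alpha> \<beta>)" and ?q = "smult (c \<alpha> \<beta>) (dimension_poly \<sigma> \<tau>)"
  have "poly ?p (real N) = poly ?q (real N)" for N
    by (simp add: poly_dimension_poly assms(1) c_def)
  then have "range real \<subseteq> {x. poly (?p - ?q) x = 0}" by auto
  then have "infinite {x. poly (?p - ?q) x = 0}"
    using infinite_super range_inj_infinite[of real] by (auto simp: inj_on_def)
  then have "?p = ?q" using poly_roots_finite[of "?p - ?q"] by auto
  then have "Polynomial.order r (dimension_poly \<alpha> \<beta>) = Polynomial.order r (dimension_poly \<sigma> \<tau>)" for r
    using c by (metis order_smult)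
  then show "length (filter (\<lambda>k. k > m) \<alpha>) = length (filter (\<lambda>k. k > m) \<sigma>)"
    and "length (filter (\<lambda>k. k > m) \<beta>) = length (filter (\<lambda>k. k > m) \<tau>)"
    using order_dimension_poly_negative[OF assms(2)] order_dimension_poly_positive[OF assms(2)]
    by metis+
qed

lemma partition_split_ones:
  assumes "is_partition \<alpha>"
  obtains a where "\<alpha> = filter (\<lambda>k. k > 1) \<alpha> @ replicate a 1"
proof -
  have "\<exists>a. \<alpha> = filter (\<lambda>k. k > 1) \<alpha> @ replicate a 1"
    using assms
  proof (induction \<alpha>)
    case (Cons k \<alpha>)
    show ?case
    proof (cases "k > 1")
      case True with Cons show ?thesis by (auto simp: is_partition_def)
    next
      case False
      with Cons.prems have "\<forall>j\<in>set (k # \<alpha>). j = 1" 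
        by (auto simp: is_partition_def) (metis One_nat_def Suc_leI le_antisym le_trans neq0_conv not_less)+
      then have "filter (\<lambda>k. k > 1) (k # \<alpha>) = []" "k # \<alpha> = replicate (length (k # \<alpha>)) 1"
        using replicate_length_same[of "k # \<alpha>" 1] by (auto simp: filter_empty_conv)
      then show ?thesis by (metis append_Nil)
    qed
  qed simp
  then show thesis using that by blast
qed

text \<open>
  The number of parts equal to \<open>m \<ge> 2\<close> is the number above \<open>m - 1\<close> minus the number above \<open>m\<close>; the
  common partition \<open>\<rho>\<close> consists of the parts above \<open>1\<close>.
\<close>

lemma partitions_with_equal_long_parts:
  assumes "is_partition \<alpha>" "is_partition \<sigma>"
    and "\<And>m. m \<ge> 1 \<Longrightarrow> length (filter (\<lambda>k. k > m) \<alpha>) = length (filter (\<lambda>k. k > m) \<sigma>)"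
  obtains \<rho> a b where "is_partition \<rho>" "\<alpha> = \<rho> @ replicate a 1" "\<sigma> = \<rho> @ replicate b 1"
proof -
  \<comment> \<open>As \<open>m \<ge> 1\<close>, the subtraction \<open>m - 1\<close> is not truncated.\<close>
  have cnt: "count (mset \<mu>) m = length (filter (\<lambda>k. k > m - 1) \<mu>) - length (filter (\<lambda>k. k > m) \<mu>)"
    if "m \<ge> 1" for m and \<mu> :: "nat list"
  proof (induction \<mu>)
    case (Cons k \<mu>)
    have "length (filter (\<lambda>k. k > m) \<mu>) \<le> length (filter (\<lambda>k. k > m - 1) \<mu>)"
      by (induction \<mu>) auto
    then show ?case using that Cons by auto
  qed simp
  have "mset (filter (\<lambda>k. k > 1) \<alpha>) = mset (filter (\<lambda>k. k > 1) \<sigma>)"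
  proof (rule multiset_eqI)
    fix m show "count (mset (filter (\<lambda>k. k > 1) \<alpha>)) m = count (mset (filter (\<lambda>k. k > 1) \<sigma>)) m"
      using cnt[of m \<alpha>] cnt[of m \<sigma>] assms(3)[of m] assms(3)[of "m-1"]
      by (simp add: mset_filter del: count_mset)
  qed
  moreover have s: "sorted_wrt (\<ge>) (filter (\<lambda>k. k > 1) \<mu>)" if "is_partition \<mu>" for \<mu>
    using that by (auto simp: is_partition_def sorted_wrt_filter)
  ultimately have "rev (filter (\<lambda>k. k > 1) \<alpha>) = rev (filter (\<lambda>k. k > 1) \<sigma>)"
    using s[OF assms(1)] s[OF assms(2)]
    by (intro trans[OF properties_for_sort[symmetric] properties_for_sort[OF refl]]) (simp_all add: sorted_wrt_rev)
  then have eq: "filter (\<lambda>k. k > 1) \<alpha> = filter (\<lambda>k. k > 1) \<sigma>" by simp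
  have "is_partition (filter (\<lambda>k. k > 1) \<alpha>)"
    using s[OF assms(1)] by (auto simp: is_partition_def)
  then show thesis
    using that partition_split_ones[OF assms(1)] partition_split_ones[OF assms(2)] eq by metis
qed

section \<open>Modules induced from linear characters\<close>

lemma line_module_simps:
  "carrier (line_module \<chi>) = UNIV" "act (line_module \<chi>) h v = \<chi> h * v"
  by (simp_all add: line_module_def)

text \<open>
  The module \<open>FG \<otimes> F\<close> without its relations is the group algebra. Its structure does not involve the
  character \<open>\<chi>\<close> of the line, so one ambient module serves all characters.
\<close>

abbreviation (input) group_algebra where "group_algebra G \<equiv> free_module G (line_module (\<lambda>_. 1))"

lemma free_module_line_eq: "free_module G (line_module \<chi>) = group_algebra G"
  by (simp add: free_module_def line_module_def)

lemma pure_tensor_line: "pure_tensor G (line_module \<chi>) g v = (\<lambda>x\<in>carrier G. if x = g then v else 0)"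
  by (simp add: pure_tensor_def line_module_def cong: if_cong)

lemma abelian_group_group_algebra: "abelian_group (group_algebra G)"
proof (rule abelian_groupI)
  fix x assume "x \<in> carrier (group_algebra G)"
  then show "\<exists>y\<in>carrier (group_algebra G). y \<oplus>\<^bsub>group_algebra G\<^esub> x = \<zero>\<^bsub>group_algebra G\<^esub>"
    by (intro bexI[of _ "\<lambda>g\<in>carrier G. - x g"]) (auto simp: free_module_def line_module_def)
qed (auto simp: free_module_def line_module_def PiE_iff fun_eq_iff restrict_def extensional_def algebra_simps)

lemma group_algebra_simps:
  "carrier (group_algebra G) = carrier G \<rightarrow>\<^sub>E UNIV"
  "\<zero>\<^bsub>group_algebra G\<^esub> = (\<lambda>g\<in>carrier G. 0)"
  "x \<oplus>\<^bsub>group_algebra G\<^esub> y = (\<lambda>g\<in>carrier G. x g + y g)"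
  "c \<odot>\<^bsub>group_algebra G\<^esub> x = (\<lambda>g\<in>carrier G. c * x g)"
  "act (group_algebra G) a x = (\<lambda>g\<in>carrier G. x (inv\<^bsub>G\<^esub> a \<otimes>\<^bsub>G\<^esub> g))"
  by (simp_all add: free_module_def line_module_def)

lemma a_inv_group_algebra:
  assumes "x \<in> carrier (group_algebra G)"
  shows "\<ominus>\<^bsub>group_algebra G\<^esub> x = (\<lambda>g\<in>carrier G. - x g)"
proof -
  interpret abelian_group "group_algebra G" by (rule abelian_group_group_algebra)
  show ?thesis using assms
    by (intro minus_equality) (auto simp: group_algebra_simps)
qed

definition tensor_relation ::
    "('g, 'm) monoid_scheme \<Rightarrow> ('g \<Rightarrow> 'f::field) \<Rightarrow> 'g \<Rightarrow> 'g \<Rightarrow> 'f \<Rightarrow> 'g \<Rightarrow> 'f" where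
  "tensor_relation G \<chi> g h v =
     (\<lambda>x\<in>carrier G. (if x = g \<otimes>\<^bsub>G\<^esub> h then v else 0) - (if x = g then \<chi> h * v else 0))"

lemma tensor_relations_line:
  fixes \<chi> :: "'g \<Rightarrow> 'f::field"
  shows "tensor_relations G K (line_module \<chi>) =
     {tensor_relation G \<chi> g h v | g h v. g \<in> carrier G \<and> h \<in> K}"
proof -
  have "(\<lambda>x\<in>carrier G. if x = a then u else 0) \<ominus>\<^bsub>group_algebra G\<^esub> (\<lambda>x\<in>carrier G. if x = b then w else 0)
     = (\<lambda>x\<in>carrier G. (if x = a then u else 0) - (if x = b then w else 0))" for a b and u w :: 'f
    by (subst a_minus_def, subst a_inv_group_algebra) (auto simp: group_algebra_simps fun_eq_iff restrict_def)
  then show ?thesis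
    unfolding tensor_relations_def free_module_line_eq[of G \<chi>] pure_tensor_line tensor_relation_def
      line_module_simps by simp
qed

definition relation_span :: "('g, 'm) monoid_scheme \<Rightarrow> 'g set \<Rightarrow> ('g \<Rightarrow> 'f::field) \<Rightarrow> ('g \<Rightarrow> 'f) set" where
  "relation_span G K \<chi> = generate (add_monoid (group_algebra G)) (tensor_relations G K (line_module \<chi>))"

lemma induced_line_module:
  "induced_module G K (line_module \<chi>) = quotient_module (group_algebra G) (relation_span G K \<chi>)"
  by (simp add: induced_module_def relation_span_def free_module_line_eq[of G \<chi>])

lemma tensor_relation_in_carrier: "tensor_relation G \<chi> g h v \<in> carrier (group_algebra G)"
  by (simp add: tensor_relation_def group_algebra_simps)

lemma tensor_relations_subset: "tensor_relations G K (line_module \<chi>) \<subseteq> carrier (group_algebra G)"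
  by (auto simp: tensor_relations_line tensor_relation_in_carrier)

lemma abelian_subgroup_relation_span: "abelian_subgroup (relation_span G K \<chi>) (group_algebra G)"
proof (rule abelian_subgroupI3)
  interpret abelian_group "group_algebra G" by (rule abelian_group_group_algebra)
  show "additive_subgroup (relation_span G K \<chi>) (group_algebra G)"
    unfolding relation_span_def
    by (intro additive_subgroup.intro add.generate_is_subgroup) (simp add: tensor_relations_subset)
qed (rule abelian_group_group_algebra)

lemma group_group_algebra: "group (add_monoid (group_algebra G))"
  using abelian_group_group_algebra abelian_group.a_group by blast

text \<open>
  A map that respects the generating relations respects their span. This gives closure of the span
  under scalars and under the group, and later the transfer between conjugate subgroups.
\<close>

lemma relation_span_image:
  assumes hom: "f \<in> hom (add_monoid (group_algebra G)) (add_monoid (group_algebra G))"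
    and rel: "\<And>g h v. g \<in> carrier G \<Longrightarrow> h \<in> K \<Longrightarrow>
      f (tensor_relation G \<chi> g h v) \<in> tensor_relations G K' (line_module \<chi>')"
    and x: "x \<in> relation_span G K \<chi>"
  shows "f x \<in> relation_span G K' \<chi>'"
proof -
  interpret A: group "add_monoid (group_algebra G)" by (rule group_group_algebra)
  interpret group_hom "add_monoid (group_algebra G)" "add_monoid (group_algebra G)" f
    using hom by (simp add: group_hom_def group_hom_axioms_def group_group_algebra)
  have "f x \<in> f ` generate (add_monoid (group_algebra G)) (tensor_relations G K (line_module \<chi>))"
    using x by (simp add: relation_span_def)
  also have "\<dots> = generate (add_monoid (group_algebra G)) (f ` tensor_relations G K (line_module \<chi>))"
    by (rule generate_img[symmetric]) (simp add: tensor_relations_subset)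
  also have "\<dots> \<subseteq> relation_span G K' \<chi>'"
    unfolding relation_span_def
    by (rule A.mono_generate) (auto simp: tensor_relations_line[of G K] rel)
  finally show ?thesis .
qed

lemma smult_hom: "(\<odot>\<^bsub>group_algebra G\<^esub>) c \<in> hom (add_monoid (group_algebra G)) (add_monoid (group_algebra G))"
  by (auto simp: hom_def group_algebra_simps fun_eq_iff algebra_simps)

lemma smult_relation_span:
  assumes "x \<in> relation_span G K \<chi>"
  shows "c \<odot>\<^bsub>group_algebra G\<^esub> x \<in> relation_span G K \<chi>"
proof (rule relation_span_image[OF smult_hom _ assms])
  fix g h v assume "g \<in> carrier G" "h \<in> K"
  moreover have "c \<odot>\<^bsub>group_algebra G\<^esub> tensor_relation G \<chi> g h v = tensor_relation G \<chi> g h (c * v)"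
    by (auto simp: group_algebra_simps tensor_relation_def fun_eq_iff algebra_simps)
  ultimately show "c \<odot>\<^bsub>group_algebra G\<^esub> tensor_relation G \<chi> g h v \<in> tensor_relations G K (line_module \<chi>)"
    by (auto simp: tensor_relations_line)
qed

context group begin

lemma act_hom: "act (group_algebra G) a \<in> hom (add_monoid (group_algebra G)) (add_monoid (group_algebra G))" if "a \<in> carrier G"
  using that by (auto simp: hom_def group_algebra_simps fun_eq_iff)

lemma inv_mult_eq_iff:
  assumes "a \<in> carrier G" "x \<in> carrier G" "g \<in> carrier G"
  shows "inv a \<otimes> x = g \<longleftrightarrow> x = a \<otimes> g"
  using inv_solve_left[OF assms(3,1,2)] by (rule back_subst[of "\<lambda>P. P \<longleftrightarrow> _"]) (rule eq_commute)

lemma act_relation_span: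
  assumes "x \<in> relation_span G K \<chi>" "a \<in> carrier G" "K \<subseteq> carrier G"
  shows "act (group_algebra G) a x \<in> relation_span G K \<chi>"
proof (rule relation_span_image[OF act_hom _ assms(1)])
  show "a \<in> carrier G" by fact
  fix g h v assume gh: "g \<in> carrier G" "h \<in> K"
  then have "act (group_algebra G) a (tensor_relation G \<chi> g h v) = tensor_relation G \<chi> (a \<otimes> g) h v"
    unfolding group_algebra_simps tensor_relation_def
    using assms(2,3) by (intro restrict_ext) (simp add: inv_mult_eq_iff m_assoc subset_iff)
  with gh assms(2) show "act (group_algebra G) a (tensor_relation G \<chi> g h v) \<in> tensor_relations G K (line_module \<chi>)"
    by (auto simp: tensor_relations_line) 
qed

end

text \<open>
  The operations of a quotient module are unions over all representatives; for an additive map that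
  preserves the submodule all these representatives give the same coset.
\<close>

lemma coset_union:
  assumes "abelian_subgroup N M" "f \<in> hom (add_monoid M) (add_monoid M)"
    "\<And>x. x \<in> N \<Longrightarrow> f x \<in> N" "u \<in> carrier M"
  shows "(\<Union>x\<in>N +>\<^bsub>M\<^esub> u. N +>\<^bsub>M\<^esub> f x) = N +>\<^bsub>M\<^esub> f u"
proof -
  interpret abelian_subgroup N M by fact
  have "N +>\<^bsub>M\<^esub> f x = N +>\<^bsub>M\<^esub> f u" if x: "x \<in> N +>\<^bsub>M\<^esub> u" for x
  proof -
    from x obtain n where n: "n \<in> N" "x = n \<oplus>\<^bsub>M\<^esub> u" by (auto simp: a_r_coset_def')
    have fu: "f u \<in> carrier M" using assms(2,4) by (auto simp: hom_def)
    have "f x = f n \<oplus>\<^bsub>M\<^esub> f u" using assms(2,4) n by (auto simp: hom_def)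
    then have "f x \<in> N +>\<^bsub>M\<^esub> f u" using assms(3)[OF n(1)] by (auto simp: a_r_coset_def')
    then show ?thesis by (rule a_repr_independence'[OF _ fu, symmetric])
  qed
  moreover have "u \<in> N +>\<^bsub>M\<^esub> u" using a_rcos_self assms(4) by blast
  ultimately show ?thesis by blast
qed

lemma quotient_module_simps:
  "carrier (quotient_module M N) = a_rcosets\<^bsub>M\<^esub> N"
  "add (quotient_module M N) = (<+>\<^bsub>M\<^esub>)"
  "c \<odot>\<^bsub>quotient_module M N\<^esub> X = (\<Union>x\<in>X. N +>\<^bsub>M\<^esub> (c \<odot>\<^bsub>M\<^esub> x))"
  "act (quotient_module M N) g X = (\<Union>x\<in>X. N +>\<^bsub>M\<^esub> act M g x)"
  by (simp_all add: quotient_module_def)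

context group begin

context
  fixes K :: "'a set" and \<chi> :: "'a \<Rightarrow> 'f::field"
  assumes K: "K \<subseteq> carrier G"
begin

interpretation abelian_subgroup "relation_span G K \<chi>" "group_algebra G" by (rule abelian_subgroup_relation_span)

lemma carrier_induced:
  "carrier (induced_module G K (line_module \<chi>)) = {relation_span G K \<chi> +>\<^bsub>group_algebra G\<^esub> u | u. u \<in> carrier (group_algebra G)}"
  by (auto simp: induced_line_module quotient_module_simps A_RCOSETS_def')

lemma add_induced:
  "u \<in> carrier (group_algebra G) \<Longrightarrow> v \<in> carrier (group_algebra G) \<Longrightarrow>
    (relation_span G K \<chi> +>\<^bsub>group_algebra G\<^esub> u) \<oplus>\<^bsub>induced_module G K (line_module \<chi>)\<^esub> (relation_span G K \<chi> +>\<^bsub>group_algebra G\<^esub> v)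
      = relation_span G K \<chi> +>\<^bsub>group_algebra G\<^esub> (u \<oplus>\<^bsub>group_algebra G\<^esub> v)"
  by (simp add: induced_line_module quotient_module_simps a_rcos_sum)

lemma smult_induced:
  "u \<in> carrier (group_algebra G) \<Longrightarrow>
    c \<odot>\<^bsub>induced_module G K (line_module \<chi>)\<^esub> (relation_span G K \<chi> +>\<^bsub>group_algebra G\<^esub> u)
      = relation_span G K \<chi> +>\<^bsub>group_algebra G\<^esub> (c \<odot>\<^bsub>group_algebra G\<^esub> u)"
  unfolding induced_line_module quotient_module_simps
  by (rule coset_union[OF abelian_subgroup_axioms smult_hom smult_relation_span])

lemma act_induced:
  "u \<in> carrier (group_algebra G) \<Longrightarrow> a \<in> carrier G \<Longrightarrow>
    act (induced_module G K (line_module \<chi>)) a (relation_span G K \<chi> +>\<^bsub>group_algebra G\<^esub> u)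
      = relation_span G K \<chi> +>\<^bsub>group_algebra G\<^esub> (act (group_algebra G) a u)"
  unfolding induced_line_module quotient_module_simps
  by (rule coset_union[OF abelian_subgroup_axioms act_hom act_relation_span[OF _ _ K]])

end
end

definition pairing :: "('g, 'm) monoid_scheme \<Rightarrow> ('g \<Rightarrow> 'f::field) \<Rightarrow> ('g \<Rightarrow> 'f) \<Rightarrow> 'f" where
  "pairing G k u = (\<Sum>x\<in>carrier G. k x * u x)"

definition point_mass :: "('g, 'm) monoid_scheme \<Rightarrow> 'g \<Rightarrow> 'f \<Rightarrow> 'g \<Rightarrow> 'f::field" where
  "point_mass G g c = (\<lambda>x\<in>carrier G. if x = g then c else 0)"

text \<open>
  The functions \<open>k\<close> for which \<open>u \<mapsto> \<Sum>\<^sub>x k x * u x\<close> factors through the module induced from \<open>\<chi>\<close>.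
\<close>

definition equivariant :: "('g, 'm) monoid_scheme \<Rightarrow> 'g set \<Rightarrow> ('g \<Rightarrow> 'f::field) \<Rightarrow> ('g \<Rightarrow> 'f) \<Rightarrow> bool" where
  "equivariant G K \<chi> k \<longleftrightarrow> (\<forall>g\<in>carrier G. \<forall>h\<in>K. k (g \<otimes>\<^bsub>G\<^esub> h) = \<chi> h * k g)"

lemma pairing_add: "pairing G k (u \<oplus>\<^bsub>group_algebra G\<^esub> v) = pairing G k u + pairing G k v"
  by (simp add: pairing_def group_algebra_simps algebra_simps sum.distrib)

lemma pairing_smult: "pairing G k (c \<odot>\<^bsub>group_algebra G\<^esub> u) = c * pairing G k u"
  by (simp add: pairing_def group_algebra_simps algebra_simps sum_distrib_left)

lemma pairing_point_mass:
  "finite (carrier G) \<Longrightarrow> g \<in> carrier G \<Longrightarrow> pairing G k (point_mass G g c) = k g * c"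
  by (simp add: pairing_def point_mass_def if_distrib[of "(*) _"] sum.delta cong: if_cong)

lemma point_mass_in_carrier: "point_mass G g c \<in> carrier (group_algebra G)"
  by (simp add: point_mass_def group_algebra_simps)

lemma smult_point_mass: "c \<odot>\<^bsub>group_algebra G\<^esub> point_mass G g d = point_mass G g (c * d)"
  by (auto simp: point_mass_def group_algebra_simps fun_eq_iff)

text \<open>
  The point masses generate the group algebra additively.
\<close>

lemma additive_eq_0_on_group_algebra:
  fixes F :: "('g \<Rightarrow> 'f::field) \<Rightarrow> 'f"
  assumes fin: "finite (carrier G)"
    and add: "\<And>u v. u \<in> carrier (group_algebra G) \<Longrightarrow> v \<in> carrier (group_algebra G) \<Longrightarrow> F (u \<oplus>\<^bsub>group_algebra G\<^esub> v) = F u + F v"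
    and pm: "\<And>g c. g \<in> carrier G \<Longrightarrow> F (point_mass G g c) = 0"
    and w: "w \<in> carrier (group_algebra G)"
  shows "F w = 0"
proof -
  let ?r = "\<lambda>S. \<lambda>x\<in>carrier G. if x \<in> S then w x else 0"
  have "F (?r S) = 0" if "S \<subseteq> carrier G" for S
    using finite_subset[OF that fin] that
  proof (induction S rule: finite_induct)
    case empty
    have z: "(\<lambda>x\<in>carrier G. 0 :: 'f) \<in> carrier (group_algebra G)" by (simp add: group_algebra_simps)
    have "(\<lambda>x\<in>carrier G. 0 :: 'f) \<oplus>\<^bsub>group_algebra G\<^esub> (\<lambda>x\<in>carrier G. 0) = (\<lambda>x\<in>carrier G. 0)"
      by (simp add: group_algebra_simps fun_eq_iff)
    then have "F (\<lambda>x\<in>carrier G. 0) = F (\<lambda>x\<in>carrier G. 0) + F (\<lambda>x\<in>carrier G. 0)"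
      using add[OF z z] by (simp only:)
    then have "F (\<lambda>x\<in>carrier G. 0) = 0" by (metis add_cancel_right_right)
    then show ?case by (simp only: empty_iff if_False)
  next
    case (insert g S)
    have "?r (insert g S) = ?r S \<oplus>\<^bsub>group_algebra G\<^esub> point_mass G g (w g)"
      using insert.hyps by (auto simp: group_algebra_simps point_mass_def fun_eq_iff)
    moreover have "F (?r S \<oplus>\<^bsub>group_algebra G\<^esub> point_mass G g (w g)) = F (?r S) + F (point_mass G g (w g))"
      by (rule add[OF _ point_mass_in_carrier]) (simp add: group_algebra_simps)
    moreover have "F (?r S) = 0" using insert.IH insert.prems by blast
    moreover have "F (point_mass G g (w g)) = 0" using pm insert.prems by blast
    ultimately show ?case by (simp only: add_0)
  qed
  from this[of "carrier G"] have "F (?r (carrier G)) = 0" by simp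
  moreover have "?r (carrier G) = w" using w by (auto simp: group_algebra_simps fun_eq_iff PiE_iff extensional_def)
  ultimately show ?thesis by simp
qed

context group begin

lemma act_point_mass:
  assumes "h \<in> carrier G" "g \<in> carrier G"
  shows "act (group_algebra G) h (point_mass G g c) = point_mass G (h \<otimes> g) c"
  unfolding group_algebra_simps point_mass_def
  using assms by (intro restrict_ext) (simp add: inv_mult_eq_iff)

lemma pairing_act:
  assumes "a \<in> carrier G"
  shows "pairing G k (act (group_algebra G) a u) = pairing G (\<lambda>x. k (a \<otimes> x)) u"
proof -
  have "(\<Sum>x\<in>carrier G. k (a \<otimes> x) * u x) = (\<Sum>x\<in>carrier G. k x * u (inv a \<otimes> x))"
    using assms by (intro sum.reindex_bij_witness[of _ "\<lambda>x. inv a \<otimes> x" "\<lambda>x. a \<otimes> x"])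
      (auto simp flip: m_assoc)
  then show ?thesis by (simp add: pairing_def group_algebra_simps)
qed

lemma pairing_relation_span:
  assumes fin: "finite (carrier G)" and K: "K \<subseteq> carrier G"
    and k: "equivariant G K \<chi> k" and u: "u \<in> relation_span G K \<chi>"
  shows "pairing G k u = 0"
proof -
  have rel: "pairing G k r = 0" if "r \<in> tensor_relations G K (line_module \<chi>)" for r
  proof -
    from that obtain g h v where r: "r = tensor_relation G \<chi> g h v" "g \<in> carrier G" "h \<in> K"
      by (auto simp: tensor_relations_line)
    with K have h: "h \<in> carrier G" by auto
    have "pairing G k r = pairing G k (point_mass G (g \<otimes> h) v) - pairing G k (point_mass G g (\<chi> h * v))"
      by (simp add: r pairing_def tensor_relation_def point_mass_def right_diff_distrib sum_subtractf)
    also have "\<dots> = 0"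
      using k r h fin by (simp add: pairing_point_mass equivariant_def)
    finally show ?thesis .
  qed
  show ?thesis
    using u unfolding relation_span_def
  proof (induction rule: generate.induct)
    case (inv r)
    then have "r \<in> carrier (group_algebra G)" using tensor_relations_subset by blast
    then have "inv\<^bsub>add_monoid (group_algebra G)\<^esub> r = (\<lambda>g\<in>carrier G. - r g)"
      using a_inv_group_algebra[of r] by (simp add: a_inv_def)
    then have "pairing G k (inv\<^bsub>add_monoid (group_algebra G)\<^esub> r) = - pairing G k r"
      by (simp add: pairing_def sum_negf)
    with rel[OF inv] show ?case by simp
  next
    case one then show ?case by (simp add: pairing_def group_algebra_simps)
  next
    case (eng x y) then show ?case using pairing_add[of G k x y] by simp
  qed (rule rel)
qed

lemma coset_eq_imp_pairing_eq:
  assumes fin: "finite (carrier G)" and K: "K \<subseteq> carrier G"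
    and k: "equivariant G K \<chi> k"
    and u: "u \<in> carrier (group_algebra G)" and v: "v \<in> carrier (group_algebra G)"
    and eq: "relation_span G K \<chi> +>\<^bsub>group_algebra G\<^esub> u = relation_span G K \<chi> +>\<^bsub>group_algebra G\<^esub> v"
  shows "pairing G k u = pairing G k v"
proof -
  interpret abelian_subgroup "relation_span G K \<chi>" "group_algebra G" by (rule abelian_subgroup_relation_span)
  have "u \<in> relation_span G K \<chi> +>\<^bsub>group_algebra G\<^esub> v" using a_rcos_self[OF u] eq by simp
  then obtain n where "n \<in> relation_span G K \<chi>" "u = n \<oplus>\<^bsub>group_algebra G\<^esub> v" by (auto simp: a_r_coset_def')
  then show ?thesis using pairing_relation_span[OF fin K k] by (simp add: pairing_add)
qed

text \<open>
  Frobenius reciprocity in coordinates. An equivariant \<open>k\<close> is a linear functional on the second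
  module; composed with the isomorphism it becomes one on the first module, whose value at the
  generator \<open>1 \<otimes> 1\<close> is \<open>\<Sum>\<^sub>x k x * u x\<close>, where \<open>u\<close> represents the image of this generator. The first
  claim holds because \<open>h\<close> in \<open>K1\<close> multiplies the generator by \<open>\<chi>1 h\<close>. The second one expresses
  injectivity: if the composite functional vanishes on all translates of the generator, then it is
  \<open>0\<close>, and so is the value of \<open>k\<close> at the generator of the second module.
\<close>

lemma induced_line_module_iso_imp_convolution:
  fixes \<chi>1 \<chi>2 :: "'a \<Rightarrow> 'f::field"
  assumes fin: "finite (carrier G)" and K1: "K1 \<subseteq> carrier G" and K2: "K2 \<subseteq> carrier G"
    and iso: "group_module_isomorphic G
      (induced_module G K1 (line_module \<chi>1)) (induced_module G K2 (line_module \<chi>2))"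
  obtains u :: "'a \<Rightarrow> 'f" where
    "\<forall>k. equivariant G K2 \<chi>2 k \<longrightarrow> (\<forall>h\<in>K1.
       (\<Sum>x\<in>carrier G. k (h \<otimes> x) * u x) = \<chi>1 h * (\<Sum>x\<in>carrier G. k x * u x))"
    "\<forall>k. equivariant G K2 \<chi>2 k \<longrightarrow>
       (\<forall>g\<in>carrier G. (\<Sum>x\<in>carrier G. k (g \<otimes> x) * u x) = 0) \<longrightarrow> k \<one> = 0"
proof -
  let ?M1 = "induced_module G K1 (line_module \<chi>1)" and ?M2 = "induced_module G K2 (line_module \<chi>2)"
  let ?c1 = "\<lambda>u. relation_span G K1 \<chi>1 +>\<^bsub>group_algebra G\<^esub> u" and ?c2 = "\<lambda>u. relation_span G K2 \<chi>2 +>\<^bsub>group_algebra G\<^esub> u"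
  interpret abelian_group "group_algebra G :: ('f, 'a \<Rightarrow> 'f, 'a) group_module" by (rule abelian_group_group_algebra)
  interpret N1: abelian_subgroup "relation_span G K1 \<chi>1" "group_algebra G" by (rule abelian_subgroup_relation_span)
  from iso obtain \<phi> where "\<phi> \<in> group_module_iso G ?M1 ?M2"
    by (auto simp: group_module_isomorphic_def)
  then have \<phi>: "\<phi> ` carrier ?M1 = carrier ?M2"
    "\<And>x y. x \<in> carrier ?M1 \<Longrightarrow> y \<in> carrier ?M1 \<Longrightarrow> \<phi> (x \<oplus>\<^bsub>?M1\<^esub> y) = \<phi> x \<oplus>\<^bsub>?M2\<^esub> \<phi> y"
    "\<And>c x. x \<in> carrier ?M1 \<Longrightarrow> \<phi> (c \<odot>\<^bsub>?M1\<^esub> x) = c \<odot>\<^bsub>?M2\<^esub> \<phi> x"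
    "\<And>g x. g \<in> carrier G \<Longrightarrow> x \<in> carrier ?M1 \<Longrightarrow> \<phi> (act ?M1 g x) = act ?M2 g (\<phi> x)"
    by (auto simp: group_module_iso_def iso_def hom_def bij_betw_def)
  have c1: "?c1 w \<in> carrier ?M1" if "w \<in> carrier (group_algebra G)" for w
    using that by (auto simp: carrier_induced[OF K1])
  have "\<exists>v. v \<in> carrier (group_algebra G) \<and> ?c2 v = \<phi> (?c1 w)" if "w \<in> carrier (group_algebra G)" for w
  proof -
    have "\<phi> (?c1 w) \<in> carrier ?M2" using \<phi>(1) c1[OF that] by blast
    then show ?thesis by (auto simp: carrier_induced[OF K2])
  qed
  \<comment> \<open>\<open>V\<close> lifts the isomorphism to representatives. It need not be additive, but its pairings
    with equivariant functions are.\<close>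
  then obtain V where V: "\<And>w. w \<in> carrier (group_algebra G) \<Longrightarrow> V w \<in> carrier (group_algebra G)"
    "\<And>w. w \<in> carrier (group_algebra G) \<Longrightarrow> ?c2 (V w) = \<phi> (?c1 w)" by metis
  have closed: "v \<oplus>\<^bsub>group_algebra G\<^esub> w \<in> carrier (group_algebra G)" "c \<odot>\<^bsub>group_algebra G\<^esub> v \<in> carrier (group_algebra G)"
    "act (group_algebra G) g v \<in> carrier (group_algebra G)" for v w c g by (simp_all add: group_algebra_simps)
  note pairing_cong = coset_eq_imp_pairing_eq[OF fin K2]
  have V_add: "pairing G k (V (v \<oplus>\<^bsub>group_algebra G\<^esub> w)) = pairing G k (V v) + pairing G k (V w)"
    if "equivariant G K2 \<chi>2 k" "v \<in> carrier (group_algebra G)" "w \<in> carrier (group_algebra G)" for k v w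
  proof -
    have "?c2 (V (v \<oplus>\<^bsub>group_algebra G\<^esub> w)) = \<phi> (?c1 v \<oplus>\<^bsub>?M1\<^esub> ?c1 w)"
      by (simp only: V(2)[OF closed(1)] add_induced[OF K1 that(2,3)])
    also have "\<dots> = ?c2 (V v) \<oplus>\<^bsub>?M2\<^esub> ?c2 (V w)"
      by (simp only: \<phi>(2)[OF c1 c1, OF that(2,3)] V(2)[OF that(2)] V(2)[OF that(3)])
    also have "\<dots> = ?c2 (V v \<oplus>\<^bsub>group_algebra G\<^esub> V w)"
      by (rule add_induced[OF K2 V(1) V(1), OF that(2,3)])
    finally have "?c2 (V (v \<oplus>\<^bsub>group_algebra G\<^esub> w)) = ?c2 (V v \<oplus>\<^bsub>group_algebra G\<^esub> V w)" .
    from pairing_cong[OF that(1) V(1)[OF closed(1)] closed(1) this] show ?thesis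
      by (simp only: pairing_add)
  qed
  have V_smult: "pairing G k (V (c \<odot>\<^bsub>group_algebra G\<^esub> w)) = c * pairing G k (V w)"
    if "equivariant G K2 \<chi>2 k" "w \<in> carrier (group_algebra G)" for k c w
  proof -
    have "?c2 (V (c \<odot>\<^bsub>group_algebra G\<^esub> w)) = \<phi> (c \<odot>\<^bsub>?M1\<^esub> ?c1 w)"
      by (simp only: V(2)[OF closed(2)] smult_induced[OF K1 that(2)])
    also have "\<dots> = c \<odot>\<^bsub>?M2\<^esub> ?c2 (V w)"
      by (simp only: \<phi>(3)[OF c1[OF that(2)]] V(2)[OF that(2)])
    also have "\<dots> = ?c2 (c \<odot>\<^bsub>group_algebra G\<^esub> V w)"
      by (rule smult_induced[OF K2 V(1)[OF that(2)]])
    finally have "?c2 (V (c \<odot>\<^bsub>group_algebra G\<^esub> w)) = ?c2 (c \<odot>\<^bsub>group_algebra G\<^esub> V w)" .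
    from pairing_cong[OF that(1) V(1)[OF closed(2)] closed(2) this] show ?thesis
      by (simp only: pairing_smult)
  qed
  have V_act: "pairing G k (V (act (group_algebra G) g w)) = pairing G (\<lambda>x. k (g \<otimes> x)) (V w)"
    if "equivariant G K2 \<chi>2 k" "w \<in> carrier (group_algebra G)" "g \<in> carrier G" for k g w
  proof -
    have "?c2 (V (act (group_algebra G) g w)) = \<phi> (act ?M1 g (?c1 w))"
      by (simp only: V(2)[OF closed(3)] act_induced[OF K1 that(2,3)])
    also have "\<dots> = act ?M2 g (?c2 (V w))"
      by (simp only: \<phi>(4)[OF that(3) c1[OF that(2)]] V(2)[OF that(2)])
    also have "\<dots> = ?c2 (act (group_algebra G) g (V w))"
      by (rule act_induced[OF K2 V(1)[OF that(2)] that(3)])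
    finally have "?c2 (V (act (group_algebra G) g w)) = ?c2 (act (group_algebra G) g (V w))" .
    from pairing_cong[OF that(1) V(1)[OF closed(3)] closed(3) this] show ?thesis
      by (simp only: pairing_act[OF that(3)])
  qed
  have pm: "point_mass G g (c :: 'f) \<in> carrier (group_algebra G)" for g c by (rule point_mass_in_carrier)
  define u where "u = V (point_mass G \<one> 1)"
  have V_pm: "pairing G k (V (point_mass G g c)) = c * pairing G (\<lambda>x. k (g \<otimes> x)) u"
    if "equivariant G K2 \<chi>2 k" "g \<in> carrier G" for k g c
    using V_smult[OF that(1) pm[of g 1], of c] V_act[OF that(1) pm[of \<one> 1] that(2)] that(2)
    by (simp add: smult_point_mass act_point_mass u_def)
  show thesis
  proof (rule that; intro allI impI ballI)
    fix k h assume k: "equivariant G K2 \<chi>2 k" and h: "h \<in> K1"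
    then have hG: "h \<in> carrier G" using K1 by blast
    have "?c1 (point_mass G h 1) = ?c1 (point_mass G \<one> (\<chi>1 h))"
    proof -
      have "tensor_relation G \<chi>1 \<one> h 1 \<in> relation_span G K1 \<chi>1"
        unfolding relation_span_def using h by (intro generate.incl) (auto simp: tensor_relations_line)
      moreover have "point_mass G h 1 = tensor_relation G \<chi>1 \<one> h 1 \<oplus>\<^bsub>group_algebra G\<^esub> point_mass G \<one> (\<chi>1 h)"
        using hG by (auto simp: point_mass_def tensor_relation_def group_algebra_simps fun_eq_iff)
      ultimately have "point_mass G h 1 \<in> ?c1 (point_mass G \<one> (\<chi>1 h))"
        by (auto simp: a_r_coset_def')
      then show ?thesis by (rule N1.a_repr_independence'[OF _ pm, symmetric])
    qed
    then have "?c2 (V (point_mass G h 1)) = ?c2 (V (point_mass G \<one> (\<chi>1 h)))"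
      by (simp add: V pm)
    from pairing_cong[OF k _ _ this]
    have "pairing G (\<lambda>x. k (h \<otimes> x)) u = \<chi>1 h * pairing G (\<lambda>x. k (\<one> \<otimes> x)) u"
      using V_pm[OF k hG, of 1] V_pm[OF k one_closed, of "\<chi>1 h"] V pm by simp
    then show "(\<Sum>x\<in>carrier G. k (h \<otimes> x) * u x) = \<chi>1 h * (\<Sum>x\<in>carrier G. k x * u x)"
      by (simp add: pairing_def)
  next
    fix k assume k: "equivariant G K2 \<chi>2 k"
      and zero: "\<forall>g\<in>carrier G. (\<Sum>x\<in>carrier G. k (g \<otimes> x) * u x) = 0"
    have "?c2 (point_mass G \<one> 1) \<in> \<phi> ` carrier ?M1"
      unfolding \<phi>(1) using pm by (auto simp: carrier_induced[OF K2])
    then obtain w where w: "w \<in> carrier (group_algebra G)" "?c2 (V w) = ?c2 (point_mass G \<one> 1)"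
      by (auto simp: carrier_induced[OF K1] V)
    have "pairing G k (V w) = 0"
    proof (rule additive_eq_0_on_group_algebra[OF fin V_add[OF k] _ w(1)])
      fix g c assume g: "g \<in> carrier G"
      show "pairing G k (V (point_mass G g c)) = 0"
        unfolding V_pm[OF k g] using zero g by (simp add: pairing_def)
    qed
    also have "pairing G k (V w) = k \<one>"
      using pairing_cong[OF k _ pm w(2)] V w(1) fin by (simp add: pairing_point_mass)
    finally show "k \<one> = 0" .
  qed
qed

text \<open>
  Right multiplication by \<open>t\<close>, that is, \<open>g \<otimes> v \<mapsto> g t \<otimes> v\<close>.
\<close>

definition translate :: "'a \<Rightarrow> ('a \<Rightarrow> 'f::field) \<Rightarrow> 'a \<Rightarrow> 'f" where
  "translate t u = (\<lambda>g\<in>carrier G. u (g \<otimes> inv t))"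

lemma translate_hom: "t \<in> carrier G \<Longrightarrow> translate t \<in> hom (add_monoid (group_algebra G)) (add_monoid (group_algebra G))"
  by (auto simp: hom_def group_algebra_simps translate_def fun_eq_iff)

lemma translate_translate:
  assumes "t \<in> carrier G" "s \<in> carrier G" "t \<otimes> s = \<one>" "u \<in> carrier (group_algebra G)"
  shows "translate t (translate s u) = u"
proof -
  have "inv t = s" using assms by (metis inv_equality inv_comm)
  then show ?thesis using assms
    by (auto simp: translate_def group_algebra_simps fun_eq_iff PiE_iff extensional_def m_assoc)
qed

text \<open>
  Right multiplication by \<open>t\<close> sends the relation for \<open>(g, h)\<close> to the one for
  \<open>(g t, t\<^sup>-\<^sup>1 h t)\<close>.
\<close>

lemma translate_relation_span:
  assumes t: "t \<in> carrier G" and K: "K \<subseteq> carrier G"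
    and conj: "\<And>h. h \<in> K \<Longrightarrow> inv t \<otimes> h \<otimes> t \<in> K' \<and> \<chi>' (inv t \<otimes> h \<otimes> t) = \<chi> h"
    and u: "u \<in> relation_span G K \<chi>"
  shows "translate t u \<in> relation_span G K' \<chi>'"
proof (rule relation_span_image[OF translate_hom[OF t] _ u])
  fix g h v assume gh: "g \<in> carrier G" "h \<in> K"
  then have h: "h \<in> carrier G" using K by blast
  have "x \<otimes> inv t = y \<longleftrightarrow> x = y \<otimes> t" if "x \<in> carrier G" "y \<in> carrier G" for x y
    using inv_solve_right'[of y x t] that t by (simp add: eq_commute)
  moreover have "g \<otimes> t \<otimes> (inv t \<otimes> h \<otimes> t) = g \<otimes> h \<otimes> t"
    using gh h t by (simp add: m_assoc inv_solve_left flip: m_assoc[of t "inv t"])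
  ultimately have "translate t (tensor_relation G \<chi> g h v) = tensor_relation G \<chi>' (g \<otimes> t) (inv t \<otimes> h \<otimes> t) v"
    unfolding translate_def tensor_relation_def using gh h t conj[OF gh(2)]
    by (intro restrict_ext) simp
  then show "translate t (tensor_relation G \<chi> g h v) \<in> tensor_relations G K' (line_module \<chi>')"
    using conj[OF gh(2)] gh(1) t by (auto simp: tensor_relations_line)
qed

lemma translate_coset:
  assumes t: "t \<in> carrier G" and s: "s \<in> carrier G" and "t \<otimes> s = \<one>"
    and N: "\<And>u. u \<in> relation_span G K \<chi> \<Longrightarrow> translate t u \<in> relation_span G K' \<chi>'"
    and N': "\<And>u. u \<in> relation_span G K' \<chi>' \<Longrightarrow> translate s u \<in> relation_span G K \<chi>"
    and u: "u \<in> carrier (group_algebra G)"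
  shows "translate t ` (relation_span G K \<chi> +>\<^bsub>group_algebra G\<^esub> u) = relation_span G K' \<chi>' +>\<^bsub>group_algebra G\<^esub> translate t u"
proof -
  interpret N1: abelian_subgroup "relation_span G K \<chi>" "group_algebra G" by (rule abelian_subgroup_relation_span)
  interpret N2: abelian_subgroup "relation_span G K' \<chi>'" "group_algebra G" by (rule abelian_subgroup_relation_span)
  have add: "translate t (n \<oplus>\<^bsub>group_algebra G\<^esub> u) = translate t n \<oplus>\<^bsub>group_algebra G\<^esub> translate t u"
    if "n \<in> carrier (group_algebra G)" for n using translate_hom[OF t] that u by (auto simp: hom_def)
  show ?thesis
  proof (intro equalityI subsetI)
    fix y assume "y \<in> translate t ` (relation_span G K \<chi> +>\<^bsub>group_algebra G\<^esub> u)"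
    then show "y \<in> relation_span G K' \<chi>' +>\<^bsub>group_algebra G\<^esub> translate t u"
      using N add by (auto simp: a_r_coset_def')
  next
    fix y assume "y \<in> relation_span G K' \<chi>' +>\<^bsub>group_algebra G\<^esub> translate t u"
    then obtain n where n: "n \<in> relation_span G K' \<chi>'" "y = n \<oplus>\<^bsub>group_algebra G\<^esub> translate t u"
      by (auto simp: a_r_coset_def')
    then have "y = translate t (translate s n \<oplus>\<^bsub>group_algebra G\<^esub> u)"
      using add[OF N1.a_Hcarr[OF N'[OF n(1)]]] translate_translate[OF t s assms(3) N2.a_Hcarr] by simp
    then show "y \<in> translate t ` (relation_span G K \<chi> +>\<^bsub>group_algebra G\<^esub> u)"
      using N'[OF n(1)] by (auto simp: a_r_coset_def')
  qed
qed

text \<open>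
  Right multiplication by \<open>t\<close> commutes with the action from the left and matches the two spans of
  relations, so mapping cosets to their images is an isomorphism.
\<close>

lemma conjugate_induced_line_modules_isomorphic:
  fixes \<chi>1 \<chi>2 :: "'a \<Rightarrow> 'f::field"
  assumes t: "t \<in> carrier G" and K1: "K1 \<subseteq> carrier G" and K2: "K2 \<subseteq> carrier G"
    and conj1: "\<And>h. h \<in> K1 \<Longrightarrow> inv t \<otimes> h \<otimes> t \<in> K2 \<and> \<chi>2 (inv t \<otimes> h \<otimes> t) = \<chi>1 h"
    and conj2: "\<And>h. h \<in> K2 \<Longrightarrow> t \<otimes> h \<otimes> inv t \<in> K1"
  shows "group_module_isomorphic G
      (induced_module G K1 (line_module \<chi>1)) (induced_module G K2 (line_module \<chi>2))"
proof -
  let ?M1 = "induced_module G K1 (line_module \<chi>1)" and ?M2 = "induced_module G K2 (line_module \<chi>2)"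
  let ?c1 = "\<lambda>u. relation_span G K1 \<chi>1 +>\<^bsub>group_algebra G\<^esub> u" and ?c2 = "\<lambda>u. relation_span G K2 \<chi>2 +>\<^bsub>group_algebra G\<^esub> u"
  interpret N1: abelian_subgroup "relation_span G K1 \<chi>1" "group_algebra G" by (rule abelian_subgroup_relation_span)
  interpret N2: abelian_subgroup "relation_span G K2 \<chi>2" "group_algebra G" by (rule abelian_subgroup_relation_span)
  have it: "inv t \<in> carrier G" using t by simp
  have conj2': "\<chi>1 (t \<otimes> h \<otimes> inv t) = \<chi>2 h" if "h \<in> K2" for h
  proof -
    have h: "h \<in> carrier G" using that K2 by blast
    then have "inv t \<otimes> (t \<otimes> h \<otimes> inv t) \<otimes> t = h"
      using t by (simp add: m_assoc) (simp flip: m_assoc)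
    then show ?thesis using conj1[OF conj2[OF that]] by simp
  qed
  have R1: "translate t u \<in> relation_span G K2 \<chi>2" if "u \<in> relation_span G K1 \<chi>1" for u
    by (rule translate_relation_span[OF t K1 conj1 that])
  have R2: "translate (inv t) u \<in> relation_span G K1 \<chi>1" if "u \<in> relation_span G K2 \<chi>2" for u
    by (rule translate_relation_span[OF it K2 _ that]) (simp add: t conj2 conj2')
  have tr: "translate t u \<in> carrier (group_algebra G)" for t and u :: "'a \<Rightarrow> 'f"
    by (simp add: translate_def group_algebra_simps)
  have c: "translate t ` ?c1 u = ?c2 (translate t u)" if "u \<in> carrier (group_algebra G)" for u
    using that by (intro translate_coset[OF t it _ R1 R2]) (simp_all add: t)
  have c': "translate (inv t) ` ?c2 u = ?c1 (translate (inv t) u)" if "u \<in> carrier (group_algebra G)" for u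
    using that by (intro translate_coset[OF it t _ R2 R1]) (simp_all add: t)
  have tt: "translate t (translate (inv t) u) = u" "translate (inv t) (translate t u) = u"
    if "u \<in> carrier (group_algebra G)" for u :: "'a \<Rightarrow> 'f"
    using that t by (auto intro!: translate_translate)
  have bij: "bij_betw ((`) (translate t)) (carrier ?M1) (carrier ?M2)"
  proof (rule bij_betw_byWitness[where f' = "(`) (translate (inv t))"])
    show "\<forall>X\<in>carrier ?M1. translate (inv t) ` translate t ` X = X"
      unfolding carrier_induced[OF K1] by (intro ballI, elim CollectE exE conjE) (simp only: c c' tr tt)
    show "\<forall>X\<in>carrier ?M2. translate t ` translate (inv t) ` X = X"
      unfolding carrier_induced[OF K2] by (intro ballI, elim CollectE exE conjE) (simp only: c c' tr tt)
    show "(`) (translate t) ` carrier ?M1 \<subseteq> carrier ?M2"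
      unfolding carrier_induced[OF K1] carrier_induced[OF K2] using c tr by blast
    show "(`) (translate (inv t)) ` carrier ?M2 \<subseteq> carrier ?M1"
      unfolding carrier_induced[OF K1] carrier_induced[OF K2] using c' tr by blast
  qed
  have closed: "v \<oplus>\<^bsub>group_algebra G\<^esub> w \<in> carrier (group_algebra G)" "c \<odot>\<^bsub>group_algebra G\<^esub> v \<in> carrier (group_algebra G)"
    "act (group_algebra G) g v \<in> carrier (group_algebra G)" for v w c g by (simp_all add: group_algebra_simps)
  have tr_add: "translate t (v \<oplus>\<^bsub>group_algebra G\<^esub> w) = translate t v \<oplus>\<^bsub>group_algebra G\<^esub> translate t w"
    and tr_smult: "translate t (c \<odot>\<^bsub>group_algebra G\<^esub> v) = c \<odot>\<^bsub>group_algebra G\<^esub> translate t v" for v w :: "'a \<Rightarrow> 'f" and c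
    using t by (auto simp: translate_def group_algebra_simps fun_eq_iff)
  have tr_act: "translate t (act (group_algebra G) g v) = act (group_algebra G) g (translate t v)" if "g \<in> carrier G"
    for g and v :: "'a \<Rightarrow> 'f"
    using t that by (auto simp: translate_def group_algebra_simps fun_eq_iff m_assoc)
  let ?\<psi> = "(`) (translate t)"
  have hom: "?\<psi> (X \<oplus>\<^bsub>?M1\<^esub> Y) = ?\<psi> X \<oplus>\<^bsub>?M2\<^esub> ?\<psi> Y" "?\<psi> (a \<odot>\<^bsub>?M1\<^esub> X) = a \<odot>\<^bsub>?M2\<^esub> ?\<psi> X"
    "g \<in> carrier G \<Longrightarrow> ?\<psi> (act ?M1 g X) = act ?M2 g (?\<psi> X)"
    if "X \<in> carrier ?M1" "Y \<in> carrier ?M1" for X Y a g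
  proof -
    from that obtain u v where uv: "u \<in> carrier (group_algebra G)" "v \<in> carrier (group_algebra G)" "X = ?c1 u" "Y = ?c1 v"
      by (auto simp: carrier_induced[OF K1])
    show "?\<psi> (X \<oplus>\<^bsub>?M1\<^esub> Y) = ?\<psi> X \<oplus>\<^bsub>?M2\<^esub> ?\<psi> Y"
      by (simp only: uv add_induced[OF K1] add_induced[OF K2] c closed tr tr_add)
    show "?\<psi> (a \<odot>\<^bsub>?M1\<^esub> X) = a \<odot>\<^bsub>?M2\<^esub> ?\<psi> X"
      by (simp only: uv smult_induced[OF K1] smult_induced[OF K2] c closed tr tr_smult)
    show "?\<psi> (act ?M1 g X) = act ?M2 g (?\<psi> X)" if "g \<in> carrier G"
      by (simp only: uv act_induced[OF K1] act_induced[OF K2] c closed tr tr_act that)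
  qed
  have "?\<psi> \<in> group_module_iso G ?M1 ?M2"
    unfolding group_module_iso_def iso_def hom_def
    using bij bij_betwE[OF bij] hom by simp
  then show ?thesis by (auto simp: group_module_isomorphic_def)
qed

end

text \<open>
  Records carry no closure axioms; the inverse map is a homomorphism as soon as the operations of
  \<open>M\<close> stay in its carrier.
\<close>

lemma group_module_isomorphic_sym:
  assumes add: "\<And>x y. x \<in> carrier M \<Longrightarrow> y \<in> carrier M \<Longrightarrow> x \<oplus>\<^bsub>M\<^esub> y \<in> carrier M"
    and smult: "\<And>c x. x \<in> carrier M \<Longrightarrow> c \<odot>\<^bsub>M\<^esub> x \<in> carrier M"
    and action: "\<And>g x. g \<in> carrier G \<Longrightarrow> x \<in> carrier M \<Longrightarrow> act M g x \<in> carrier M"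
    and iso: "group_module_isomorphic G M N"
  shows "group_module_isomorphic G N M"
proof -
  from iso obtain \<phi> where "\<phi> \<in> group_module_iso G M N" by (auto simp: group_module_isomorphic_def)
  then have bij: "bij_betw \<phi> (carrier M) (carrier N)"
    and hom: "\<And>x y. x \<in> carrier M \<Longrightarrow> y \<in> carrier M \<Longrightarrow> \<phi> (x \<oplus>\<^bsub>M\<^esub> y) = \<phi> x \<oplus>\<^bsub>N\<^esub> \<phi> y"
    "\<And>c x. x \<in> carrier M \<Longrightarrow> \<phi> (c \<odot>\<^bsub>M\<^esub> x) = c \<odot>\<^bsub>N\<^esub> \<phi> x"
    "\<And>g x. g \<in> carrier G \<Longrightarrow> x \<in> carrier M \<Longrightarrow> \<phi> (act M g x) = act N g (\<phi> x)"
    by (auto simp: group_module_iso_def iso_def hom_def)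
  let ?\<psi> = "inv_into (carrier M) \<phi>"
  have bij': "bij_betw ?\<psi> (carrier N) (carrier M)" using bij by (rule bij_betw_inv_into)
  have \<psi>: "?\<psi> (\<phi> x) = x" if "x \<in> carrier M" for x
    using bij that by (simp add: bij_betw_def inv_into_f_f)
  have ex: "\<exists>x\<in>carrier M. y = \<phi> x" if "y \<in> carrier N" for y
    using bij that by (auto simp: bij_betw_def)
  have "?\<psi> (y \<oplus>\<^bsub>N\<^esub> y') = ?\<psi> y \<oplus>\<^bsub>M\<^esub> ?\<psi> y'" if "y \<in> carrier N" "y' \<in> carrier N" for y y'
    using ex[OF that(1)] ex[OF that(2)] by (auto simp: \<psi> add simp flip: hom(1))
  moreover have "?\<psi> (c \<odot>\<^bsub>N\<^esub> y) = c \<odot>\<^bsub>M\<^esub> ?\<psi> y" if "y \<in> carrier N" for c y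
    using ex[OF that] by (auto simp: \<psi> smult simp flip: hom(2))
  moreover have "?\<psi> (act N g y) = act M g (?\<psi> y)" if "g \<in> carrier G" "y \<in> carrier N" for g y
    using ex[OF that(2)] that(1) by (auto simp: \<psi> action simp flip: hom(3))
  ultimately have "?\<psi> \<in> group_module_iso G N M"
    using bij' bij_betwE[OF bij'] by (simp add: group_module_iso_def iso_def hom_def)
  then show ?thesis by (auto simp: group_module_isomorphic_def)
qed

lemma (in group) induced_line_module_isomorphic_sym:
  assumes K: "K \<subseteq> carrier G"
    and "group_module_isomorphic G (induced_module G K (line_module \<chi>)) M"
  shows "group_module_isomorphic G M (induced_module G K (line_module \<chi>))"
proof (rule group_module_isomorphic_sym[OF _ _ _ assms(2)])
  let ?M = "induced_module G K (line_module \<chi>)"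
  have closed: "v \<oplus>\<^bsub>group_algebra G\<^esub> w \<in> carrier (group_algebra G)" "c \<odot>\<^bsub>group_algebra G\<^esub> v \<in> carrier (group_algebra G)"
    "act (group_algebra G) g v \<in> carrier (group_algebra G)" for v w c g by (simp_all add: group_algebra_simps)
  fix x y g c assume x: "x \<in> carrier ?M"
  then obtain v where v: "v \<in> carrier (group_algebra G)" "x = relation_span G K \<chi> +>\<^bsub>group_algebra G\<^esub> v"
    by (auto simp: carrier_induced[OF K])
  show "c \<odot>\<^bsub>?M\<^esub> x \<in> carrier ?M"
    unfolding v(2) smult_induced[OF K v(1)] carrier_induced[OF K] using closed(2) by blast
  show "act ?M g x \<in> carrier ?M" if "g \<in> carrier G"
    unfolding v(2) act_induced[OF K v(1) that] carrier_induced[OF K] using closed(3) by blast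
  show "x \<oplus>\<^bsub>?M\<^esub> y \<in> carrier ?M" if "y \<in> carrier ?M"
  proof -
    from that obtain w where w: "w \<in> carrier (group_algebra G)" "y = relation_span G K \<chi> +>\<^bsub>group_algebra G\<^esub> w"
      by (auto simp: carrier_induced[OF K])
    show ?thesis
      unfolding v(2) w(2) add_induced[OF K v(1) w(1)] carrier_induced[OF K] using closed(1) by blast
  qed
qed



section \<open>Functions on colourings that transform by a sign\<close>

lemma count_image_mset_mset_set:
  "finite S \<Longrightarrow> count (image_mset f (mset_set S)) y = card {x\<in>S. f x = y}"
  by (simp add: count_image_mset vimage_def Int_def conj_commute)

lemma exists_image_mset_mset_set:
  assumes "finite S" "size M = card S"
  shows "\<exists>f. image_mset f (mset_set S) = M"
  using assms
proof (induction S arbitrary: M rule: finite_induct)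
  case empty then show ?case by simp
next
  case (insert x S)
  then obtain a M' where M: "M = add_mset a M'" "size M' = card S"
    by (metis card_insert_disjoint size_eq_Suc_imp_eq_union size_Suc_Diff1 union_mset_add_mset_right
        add.right_neutral nat.inject size_add_mset)
  with insert.IH obtain f where f: "image_mset f (mset_set S) = M'" by blast
  have "image_mset (f(x := a)) (mset_set S) = image_mset f (mset_set S)"
    using insert.hyps by (intro image_mset_cong) auto
  then show ?case using insert.hyps f M(1)
    by (intro exI[of _ "f(x := a)"]) (simp only: mset_set.insert image_mset_add_mset fun_upd_same simp_thms)
qed

lemma perm_restrict_permutes:
  assumes "h permutes \<Omega>" "h ` S = S"
  shows "perm_restrict h S permutes S"
proof (rule bij_imp_permutes)
  have "inj_on h S" using assms(1) permutes_inj inj_on_subset by blast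
  then show "bij_betw (perm_restrict h S) S S"
    using assms(2) by (auto simp: bij_betw_def inj_on_def perm_restrict_def image_def)
qed (simp add: perm_restrict_def)

text \<open>
  A set partition of \<open>\<Omega>\<close> into blocks, those with index in \<open>J\<close> being signed. This is the data of a Young
  subgroup together with a character that is the sign on the factors in \<open>J\<close> and trivial on the others.
\<close>

locale signed_blocks =
  fixes \<Omega> :: "'x set" and I J :: "'i set" and P :: "'i \<Rightarrow> 'x set"
  assumes finite_points: "finite \<Omega>" and finite_blocks: "finite I" and J_subset: "J \<subseteq> I"
    and cover: "(\<Union>i\<in>I. P i) = \<Omega>" and disjoint: "disjoint_family_on P I"
begin

definition stabilizer :: "('x \<Rightarrow> 'x) set" where
  "stabilizer = {\<pi>. \<pi> permutes \<Omega> \<and> (\<forall>i\<in>I. \<pi> ` P i = P i)}"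

definition signed_points :: "'x set" where
  "signed_points = (\<Union>i\<in>J. P i)"

definition block_sign :: "('x \<Rightarrow> 'x) \<Rightarrow> int" where
  "block_sign \<pi> = sign (perm_restrict \<pi> signed_points)"

definition block_colours :: "('x \<Rightarrow> nat) \<Rightarrow> 'i \<Rightarrow> nat multiset" where
  "block_colours c = (\<lambda>i\<in>I. image_mset c (mset_set (P i)))"

text \<open>
  The possible multisets of colours in each block, for colourings that are injective on signed blocks.
  They index the orbits that carry a nonzero skew function.
\<close>

definition colour_types :: "nat \<Rightarrow> ('i \<Rightarrow> nat multiset) set" where
  "colour_types N = (\<Pi>\<^sub>E i\<in>I. {M. set_mset M \<subseteq> {..<N} \<and> size M = card (P i) \<and>
     (i \<in> J \<longrightarrow> (\<forall>x. count M x \<le> 1))})"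

text \<open>
  Colourings are \<open>undefined\<close> outside \<open>\<Omega>\<close>, so composition with a permutation of \<open>\<Omega>\<close> gives a
  colouring again.
\<close>

definition skew_functions :: "nat \<Rightarrow> (('x \<Rightarrow> nat) \<Rightarrow> 'f::field) set" where
  "skew_functions N = {f. \<forall>c \<in> \<Omega> \<rightarrow>\<^sub>E {..<N}. \<forall>h\<in>stabilizer. f (c \<circ> h) = of_int (block_sign h) * f c}"

lemma skew_functionsD:
  "f \<in> skew_functions N \<Longrightarrow> c \<in> \<Omega> \<rightarrow>\<^sub>E {..<N} \<Longrightarrow> h \<in> stabilizer \<Longrightarrow>
    f (c \<circ> h) = of_int (block_sign h) * f c"
  by (simp add: skew_functions_def del: comp_apply)

lemma finite_block: "i \<in> I \<Longrightarrow> finite (P i)"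
  using cover finite_points by (metis UN_upper finite_subset)

lemma comp_permutes_in_colourings:
  "h permutes \<Omega> \<Longrightarrow> c \<in> \<Omega> \<rightarrow>\<^sub>E A \<Longrightarrow> c \<circ> h \<in> \<Omega> \<rightarrow>\<^sub>E A"
  by (auto simp: PiE_iff extensional_def permutes_in_image permutes_not_in)

lemma stabilizer_comp: "h \<in> stabilizer \<Longrightarrow> h' \<in> stabilizer \<Longrightarrow> h \<circ> h' \<in> stabilizer"
  by (simp add: stabilizer_def permutes_compose image_comp[symmetric] del: comp_apply)

lemma stabilizer_inv:
  assumes "h \<in> stabilizer" shows "inv' h \<in> stabilizer"
proof -
  have h: "h permutes \<Omega>" using assms by (simp add: stabilizer_def)
  have "inv' h ` P i = P i" if "i \<in> I" for i
  proof -
    have "inv' h ` (h ` P i) = P i" using h by (simp add: image_comp permutes_inv_o)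
    then show ?thesis using assms that by (simp add: stabilizer_def)
  qed
  then show ?thesis using h by (simp add: stabilizer_def permutes_inv)
qed

lemma stabilizer_id: "id \<in> stabilizer"
  by (simp add: stabilizer_def permutes_id)

lemma stabilizer_signed_points: "h \<in> stabilizer \<Longrightarrow> h ` signed_points = signed_points"
  using J_subset by (simp add: stabilizer_def signed_points_def image_UN subset_iff)

lemma finite_signed_points: "finite signed_points"
  using J_subset cover finite_points unfolding signed_points_def
  by (meson UN_mono finite_subset order_refl)

lemma perm_restrict_signed_points: "h \<in> stabilizer \<Longrightarrow> perm_restrict h signed_points permutes signed_points"
  using perm_restrict_permutes stabilizer_signed_points by (auto simp: stabilizer_def)

lemma block_sign_comp:
  assumes "h \<in> stabilizer" "h' \<in> stabilizer"
  shows "block_sign (h \<circ> h') = block_sign h * block_sign h'"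
proof -
  have "perm_restrict (h \<circ> h') signed_points = perm_restrict h signed_points \<circ> perm_restrict h' signed_points"
    using stabilizer_signed_points[OF assms(2)] by (auto simp: fun_eq_iff perm_restrict_def)
  then show ?thesis
    using assms perm_restrict_signed_points finite_signed_points
    by (simp add: block_sign_def sign_compose permutes_imp_permutation)
qed

lemma block_colours_comp:
  assumes "h \<in> stabilizer" shows "block_colours (c \<circ> h) = block_colours c"
proof -
  have "image_mset (c \<circ> h) (mset_set (P i)) = image_mset c (mset_set (P i))" if "i \<in> I" for i
  proof -
    have "inj_on h (P i)" using assms permutes_inj inj_on_subset by (fastforce simp: stabilizer_def)
    then have "image_mset h (mset_set (P i)) = mset_set (P i)"
      using assms that by (simp add: image_mset_mset_set stabilizer_def)
    then show ?thesis by (metis image_mset.compositionality)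
  qed
  then show ?thesis by (auto simp: block_colours_def)
qed

text \<open>
  Each point is labelled with its block and its colour. The two labellings have the same multiset of
  labels, so a permutation of \<open>\<Omega>\<close> carries one to the other, and it preserves the blocks because the
  block is part of the label.
\<close>

lemma same_block_colours_imp_same_orbit:
  assumes c: "c \<in> \<Omega> \<rightarrow>\<^sub>E A" and c': "c' \<in> \<Omega> \<rightarrow>\<^sub>E A" and eq: "block_colours c = block_colours c'"
  obtains h where "h \<in> stabilizer" "c = c' \<circ> h"
proof -
  have "\<exists>i\<in>I. x \<in> P i" if "x \<in> \<Omega>" for x using that cover by blast
  then obtain idx where idx: "\<And>x. x \<in> \<Omega> \<Longrightarrow> idx x \<in> I \<and> x \<in> P (idx x)" by metis
  have idx_eq: "x \<in> P i \<longleftrightarrow> idx x = i" if "x \<in> \<Omega>" "i \<in> I" for x i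
    using idx[OF that(1)] disjoint that(2) by (auto simp: disjoint_family_on_def)
  have cnt: "count (image_mset (\<lambda>x. (idx x, c x)) (mset_set \<Omega>)) (i, y) =
      (if i \<in> I then count (block_colours c i) y else 0)" for c i y
  proof (cases "i \<in> I")
    case True
    then have "{x \<in> \<Omega>. (idx x, c x) = (i, y)} = {x \<in> P i. c x = y}"
      using idx_eq cover by blast
    then show ?thesis using True
      by (simp add: count_image_mset_mset_set finite_points finite_block block_colours_def)
  next
    case False
    then have "{x \<in> \<Omega>. (idx x, c x) = (i, y)} = {}" using idx by blast
    then show ?thesis using False by (simp add: count_image_mset_mset_set finite_points)
  qed
  have "image_mset (\<lambda>x. (idx x, c x)) (mset_set \<Omega>) = image_mset (\<lambda>x. (idx x, c' x)) (mset_set \<Omega>)"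
  proof (rule multiset_eqI)
    fix z show "count (image_mset (\<lambda>x. (idx x, c x)) (mset_set \<Omega>)) z
      = count (image_mset (\<lambda>x. (idx x, c' x)) (mset_set \<Omega>)) z"
      by (cases z) (simp only: cnt eq)
  qed
  from image_mset_eq_implies_permutes[OF finite_points this]
  obtain h where h: "h permutes \<Omega>" "\<forall>x\<in>\<Omega>. (idx x, c x) = (idx (h x), c' (h x))" .
  have "h ` P i = P i" if i: "i \<in> I" for i
  proof -
    have sub: "P i \<subseteq> \<Omega>" using cover i by blast
    have "h ` P i \<subseteq> P i"
    proof
      fix y assume "y \<in> h ` P i"
      then obtain x where x: "x \<in> P i" "y = h x" by blast
      then have "x \<in> \<Omega>" using sub by blast
      moreover from this have "h x \<in> \<Omega>" using h(1) by (simp add: permutes_in_image)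
      ultimately show "y \<in> P i" using x h(2) idx_eq i by auto
    qed
    moreover have "inj_on h (P i)" using h(1) permutes_inj inj_on_subset by blast
    ultimately show ?thesis by (simp add: endo_inj_surj finite_block i)
  qed
  then have "h \<in> stabilizer" using h(1) by (simp add: stabilizer_def)
  moreover have "c = c' \<circ> h"
  proof
    fix x show "c x = (c' \<circ> h) x"
      using c c' h by (cases "x \<in> \<Omega>") (auto simp: PiE_iff extensional_def permutes_not_in)
  qed
  ultimately show thesis by (rule that)
qed

lemma exists_colouring:
  assumes T: "T \<in> colour_types N"
  obtains c where "c \<in> \<Omega> \<rightarrow>\<^sub>E {..<N}" "block_colours c = T"
proof -
  have "\<exists>f. image_mset f (mset_set (P i)) = T i" if "i \<in> I" for i
    using T that by (intro exists_image_mset_mset_set finite_block) (auto simp: colour_types_def PiE_iff)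
  then obtain f where f: "\<And>i. i \<in> I \<Longrightarrow> image_mset (f i) (mset_set (P i)) = T i" by metis
  have "\<exists>i\<in>I. x \<in> P i" if "x \<in> \<Omega>" for x using that cover by blast
  then obtain idx where idx: "\<And>x. x \<in> \<Omega> \<Longrightarrow> idx x \<in> I \<and> x \<in> P (idx x)" by metis
  have idx_eq: "idx x = i" if "x \<in> P i" "i \<in> I" for x i
  proof -
    have "x \<in> \<Omega>" using that cover by blast
    then show ?thesis using idx[of x] disjoint that by (auto simp: disjoint_family_on_def)
  qed
  define c where "c = (\<lambda>x\<in>\<Omega>. f (idx x) x)"
  have ci: "image_mset c (mset_set (P i)) = T i" if "i \<in> I" for i
  proof -
    have "image_mset c (mset_set (P i)) = image_mset (f i) (mset_set (P i))"
      using that cover idx_eq by (intro image_mset_cong) (auto simp: c_def finite_block)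
    then show ?thesis using f that by simp
  qed
  have "c x < N" if "x \<in> \<Omega>" for x
  proof -
    have "c x \<in># image_mset c (mset_set (P (idx x)))" using idx[OF that] by (simp add: finite_block)
    then show ?thesis using ci idx[OF that] T by (auto simp: colour_types_def PiE_iff)
  qed
  then have "c \<in> \<Omega> \<rightarrow>\<^sub>E {..<N}" by (auto simp: c_def)
  moreover have "block_colours c = T"
    using T by (auto simp: block_colours_def ci colour_types_def PiE_iff extensional_def fun_eq_iff)
  ultimately show thesis by (rule that)
qed

lemma block_colours_in_colour_types:
  assumes "c \<in> \<Omega> \<rightarrow>\<^sub>E {..<N}"
  shows "block_colours c \<in> colour_types N \<longleftrightarrow> (\<forall>i\<in>J. inj_on c (P i))"
proof -
  have "(\<forall>y. count (image_mset c (mset_set (P i))) y \<le> 1) \<longleftrightarrow> inj_on c (P i)" if "i \<in> I" for i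
  proof -
    have fin: "finite {x \<in> P i. c x = y}" for y using finite_block[OF that] by simp
    have "(card {x \<in> P i. c x = y} \<le> 1) \<longleftrightarrow> (\<forall>x\<in>P i. \<forall>x'\<in>P i. c x = y \<longrightarrow> c x' = y \<longrightarrow> x = x')" for y
      using card_le_Suc0_iff_eq[OF fin[of y]] by auto
    then show ?thesis
      using finite_block[OF that] by (auto simp: count_image_mset_mset_set inj_on_def)
  qed
  moreover have "P i \<subseteq> \<Omega>" if "i \<in> I" for i using cover that by blast
  ultimately show ?thesis
    using J_subset assms
    by (auto simp: colour_types_def block_colours_def PiE_iff finite_block subset_iff Pi_iff)
qed

text \<open>
  If two points of a signed block have the same colour, then their transposition fixes the colouring
  and has sign \<open>-1\<close>, so \<open>f c = - f c\<close>.
\<close>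

lemma skew_function_eq_0:
  fixes f :: "('x \<Rightarrow> nat) \<Rightarrow> 'f::field"
  assumes two: "(2::'f) \<noteq> 0" and f: "f \<in> skew_functions N" and c: "c \<in> \<Omega> \<rightarrow>\<^sub>E {..<N}"
    and bad: "block_colours c \<notin> colour_types N"
  shows "f c = 0"
proof -
  from bad obtain i x y where i: "i \<in> J" and xy: "x \<in> P i" "y \<in> P i" "c x = c y" "x \<noteq> y"
    using block_colours_in_colour_types[OF c] by (auto simp: inj_on_def)
  let ?t = "Transposition.transpose x y"
  have xyO: "x \<in> \<Omega>" "y \<in> \<Omega>" and iI: "i \<in> I" using xy i J_subset cover by blast+
  have "?t ` P j = P j" if "j \<in> I" for j
  proof (cases "j = i")
    case True
    then show ?thesis using xy by (simp add: permutes_image permutes_swap_id)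
  next
    case False
    then have "x \<notin> P j" "y \<notin> P j" using xy disjoint iI that by (auto simp: disjoint_family_on_def)
    then show ?thesis by (auto simp: image_def Transposition.transpose_def)
  qed
  then have t: "?t \<in> stabilizer" using xyO by (simp add: stabilizer_def permutes_swap_id)
  have "perm_restrict ?t signed_points = ?t"
    using xy i by (intro perm_restrict_id permutes_swap_id) (auto simp: signed_points_def)
  then have "block_sign ?t = -1" using xy by (simp add: block_sign_def sign_swap_id)
  moreover have "c \<circ> ?t = c" using xy by (auto simp: fun_eq_iff Transposition.transpose_def)
  ultimately have "f c = - f c" using f c t by (force simp: skew_functions_def)
  then have "2 * f c = 0" by (metis add.right_inverse mult_2)
  then show ?thesis using two by simp
qed

definition representative :: "nat \<Rightarrow> ('i \<Rightarrow> nat multiset) \<Rightarrow> 'x \<Rightarrow> nat" where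
  "representative N T = (SOME c. c \<in> \<Omega> \<rightarrow>\<^sub>E {..<N} \<and> block_colours c = T)"

lemma representative:
  assumes "T \<in> colour_types N"
  shows "representative N T \<in> \<Omega> \<rightarrow>\<^sub>E {..<N}" "block_colours (representative N T) = T"
  using someI_ex[of "\<lambda>c. c \<in> \<Omega> \<rightarrow>\<^sub>E {..<N} \<and> block_colours c = T"] exists_colouring[OF assms]
  unfolding representative_def by blast+

lemma skew_function_determined_by_representatives:
  fixes f :: "('x \<Rightarrow> nat) \<Rightarrow> 'f::field"
  assumes two: "(2::'f) \<noteq> 0" and f: "f \<in> skew_functions N"
    and zero: "\<And>T. T \<in> colour_types N \<Longrightarrow> f (representative N T) = 0" and c: "c \<in> \<Omega> \<rightarrow>\<^sub>E {..<N}"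
  shows "f c = 0"
proof (cases "block_colours c \<in> colour_types N")
  case True
  note r = representative[OF True]
  obtain h where "h \<in> stabilizer" "c = representative N (block_colours c) \<circ> h"
    using same_block_colours_imp_same_orbit[OF c r(1)] r(2) by metis
  then have "f c = of_int (block_sign h) * f (representative N (block_colours c))"
    using skew_functionsD[OF f r(1)] by metis
  then show ?thesis using zero[OF True] by simp
qed (rule skew_function_eq_0[OF two f c])

text \<open>
  The skew function that is \<open>1\<close> at the representative of \<open>T\<close> and \<open>0\<close> off its orbit.
\<close>

definition skew_basis :: "nat \<Rightarrow> ('i \<Rightarrow> nat multiset) \<Rightarrow> ('x \<Rightarrow> nat) \<Rightarrow> 'f::field" where
  "skew_basis N T c =
     (if \<exists>h\<in>stabilizer. c = representative N T \<circ> h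
      then of_int (block_sign (SOME h. h \<in> stabilizer \<and> c = representative N T \<circ> h)) else 0)"

text \<open>
  This makes \<open>skew_basis\<close> independent of the choice of \<open>h\<close>.
\<close>

lemma fixing_permutation_block_sign:
  assumes inj: "\<forall>i\<in>J. inj_on c (P i)" and h: "h \<in> stabilizer" and fixed: "c \<circ> h = c"
  shows "block_sign h = 1"
proof -
  have "h x = x" if "x \<in> signed_points" for x
  proof -
    from that obtain i where i: "i \<in> J" "x \<in> P i" by (auto simp: signed_points_def)
    then have "h x \<in> P i" using h J_subset by (auto simp: stabilizer_def)
    moreover have "c (h x) = c x" using fixed by (metis comp_apply)
    ultimately show ?thesis using inj i by (auto simp: inj_on_def)
  qed
  then have "perm_restrict h signed_points = id" by (auto simp: perm_restrict_def fun_eq_iff)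
  then show ?thesis by (simp add: block_sign_def)
qed

lemma skew_basis_orbit:
  assumes T: "T \<in> colour_types N" and h: "h \<in> stabilizer"
  shows "skew_basis N T (representative N T \<circ> h) = of_int (block_sign h)"
proof -
  let ?r = "representative N T"
  let ?Q = "\<lambda>h'. h' \<in> stabilizer \<and> ?r \<circ> h = ?r \<circ> h'"
  define h' where "h' = (SOME h'. ?Q h')"
  have "?Q h" using h by simp
  then have h': "h' \<in> stabilizer" "?r \<circ> h = ?r \<circ> h'"
    unfolding h'_def using someI[of ?Q h] by blast+
  have bij: "bij h'" using h'(1) permutes_bij by (auto simp: stabilizer_def)
  then have o: "h' \<circ> inv' h' = id" "inv' h' \<circ> h' = id" by (simp_all add: bij_def surj_iff inj_iff)
  have "?r \<circ> (h \<circ> inv' h') = ?r"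
    by (simp only: comp_assoc[symmetric] h'(2)) (simp only: comp_assoc o comp_id)
  moreover have "\<forall>i\<in>J. inj_on ?r (P i)"
    using block_colours_in_colour_types representative[OF T] T by metis
  ultimately have "block_sign (h \<circ> inv' h') = 1"
    using fixing_permutation_block_sign stabilizer_comp[OF h stabilizer_inv[OF h'(1)]] by blast
  moreover have "block_sign h = block_sign (h \<circ> inv' h') * block_sign h'"
    using block_sign_comp[OF stabilizer_comp[OF h stabilizer_inv[OF h'(1)]] h'(1)]
    by (simp add: comp_assoc o)
  ultimately have "block_sign h' = block_sign h" by simp
  then show ?thesis using h by (auto simp: skew_basis_def h'_def)
qed

lemma skew_basis_skew:
  assumes T: "T \<in> colour_types N"
  shows "skew_basis N T \<in> skew_functions N"
  unfolding skew_functions_def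
proof (intro CollectI ballI)
  fix c h assume c: "c \<in> \<Omega> \<rightarrow>\<^sub>E {..<N}" and h: "h \<in> stabilizer"
  show "skew_basis N T (c \<circ> h) = of_int (block_sign h) * skew_basis N T c"
  proof (cases "\<exists>h'\<in>stabilizer. c = representative N T \<circ> h'")
    case True
    then obtain h' where h': "h' \<in> stabilizer" "c = representative N T \<circ> h'" by blast
    have "skew_basis N T (c \<circ> h) = of_int (block_sign (h' \<circ> h))"
      unfolding h'(2) comp_assoc by (rule skew_basis_orbit[OF T stabilizer_comp[OF h'(1) h]])
    also have "\<dots> = of_int (block_sign h) * of_int (block_sign h')"
      by (simp add: block_sign_comp[OF h'(1) h])
    also have "of_int (block_sign h') = skew_basis N T c"
      unfolding h'(2) by (rule skew_basis_orbit[OF T h'(1), symmetric])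
    finally show ?thesis .
  next
    case False
    have "\<not> (\<exists>h'\<in>stabilizer. c \<circ> h = representative N T \<circ> h')"
    proof
      assume "\<exists>h'\<in>stabilizer. c \<circ> h = representative N T \<circ> h'"
      then obtain h' where h': "h' \<in> stabilizer" "c \<circ> h = representative N T \<circ> h'" by blast
      have "h \<circ> inv' h = id" using h permutes_inv_o(1) by (auto simp: stabilizer_def)
      then have "c = (c \<circ> h) \<circ> inv' h" by (simp only: comp_assoc comp_id)
      then have "c = representative N T \<circ> (h' \<circ> inv' h)" by (simp only: h'(2) comp_assoc)
      then show False using False stabilizer_comp[OF h'(1) stabilizer_inv[OF h]] by blast
    qed
    with False show ?thesis by (simp add: skew_basis_def)
  qed
qed

lemma skew_basis_representative:
  assumes "T \<in> colour_types N" "T' \<in> colour_types N"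
  shows "skew_basis N T (representative N T') = (if T = T' then 1 else 0)"
proof (cases "T = T'")
  case True
  have "block_sign id = 1" by (simp add: block_sign_def perm_restrict_def flip: id_def)
  then show ?thesis using skew_basis_orbit[OF assms(1) stabilizer_id] True by simp
next
  case False
  have "representative N T' \<noteq> representative N T \<circ> h" if "h \<in> stabilizer" for h
    using block_colours_comp[OF that, of "representative N T"] representative(2) assms False by metis
  then show ?thesis using False by (auto simp: skew_basis_def)
qed

lemma finite_colour_types: "finite (colour_types N)"
proof -
  have "finite {M. set_mset M \<subseteq> {..<N} \<and> size M = k}" for k :: nat
  proof (rule finite_subset)
    show "{M. set_mset M \<subseteq> {..<N} \<and> size M = k} \<subseteq> mset ` {xs. set xs \<subseteq> {..<N} \<and> length xs = k}"
    proof clarify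
      fix M :: "nat multiset" assume "set_mset M \<subseteq> {..<N}" "k = size M"
      then show "M \<in> mset ` {xs. set xs \<subseteq> {..<N} \<and> length xs = size M}"
        using ex_mset[of M] by force
    qed
  qed (simp add: finite_lists_length_eq)
  then show ?thesis unfolding colour_types_def
    by (intro finite_PiE finite_blocks) (auto intro: finite_subset[rotated])
qed

end

lemma (in signed_blocks) card_colour_types:
  "card (colour_types N) =
     (\<Prod>i\<in>I. if i \<in> J then N choose card (P i) else (card (P i) + N - 1) choose card (P i))"
proof -
  have "card {M. set_mset M \<subseteq> {..<N} \<and> size M = k \<and> (i \<in> J \<longrightarrow> (\<forall>x. count M x \<le> 1))}
      = (if i \<in> J then N choose k else (k + N - 1) choose k)" for i k
    by (cases "i \<in> J") (simp_all only: card_multisets card_submsets_of_distinct simp_thms if_True if_False)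
  then show ?thesis unfolding colour_types_def by (simp only: card_PiE[OF finite_blocks])
qed

text \<open>
  If the second structure had more colour types than the first, then some nontrivial combination of
  its basis functions would have a convolution with \<open>u\<close> that vanishes at all representatives of the
  first structure, and hence everywhere. This contradicts the injectivity of the convolution.
\<close>

lemma colour_types_card_mono:
  fixes u :: "('x \<Rightarrow> 'x) \<Rightarrow> 'f::field" and I2 :: "'j set"
  assumes S1: "signed_blocks \<Omega> I1 J1 P1" and S2: "signed_blocks \<Omega> I2 J2 P2" and two: "(2::'f) \<noteq> 0"
    and skew: "\<And>f. f \<in> signed_blocks.skew_functions \<Omega> I2 J2 P2 N \<Longrightarrow>
      (\<lambda>c. \<Sum>x | x permutes \<Omega>. f (c \<circ> x) * u x) \<in> signed_blocks.skew_functions \<Omega> I1 J1 P1 N"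
    and inj: "\<And>f c. f \<in> signed_blocks.skew_functions \<Omega> I2 J2 P2 N \<Longrightarrow> c \<in> \<Omega> \<rightarrow>\<^sub>E {..<N} \<Longrightarrow>
      (\<And>c. c \<in> \<Omega> \<rightarrow>\<^sub>E {..<N} \<Longrightarrow> (\<Sum>x | x permutes \<Omega>. f (c \<circ> x) * u x) = 0) \<Longrightarrow> f c = 0"
  shows "card (signed_blocks.colour_types I2 J2 P2 N) \<le> card (signed_blocks.colour_types I1 J1 P1 N)"
proof (rule ccontr)
  interpret S1: signed_blocks \<Omega> I1 J1 P1 by fact
  interpret S2: signed_blocks \<Omega> I2 J2 P2 by fact
  let ?conv = "\<lambda>f c. \<Sum>x | x permutes \<Omega>. f (c \<circ> x) * u x"
  assume "\<not> card (S2.colour_types N) \<le> card (S1.colour_types N)"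
  then have less: "card (S1.colour_types N) < card (S2.colour_types N)" by simp
  obtain y :: "('j \<Rightarrow> nat multiset) \<Rightarrow> 'f" where y: "\<exists>T\<in>S2.colour_types N. y T \<noteq> 0"
    "\<forall>T'\<in>S1.colour_types N. (\<Sum>T\<in>S2.colour_types N.
        y T * ?conv (S2.skew_basis N T) (S1.representative N T')) = 0"
    by (rule homogeneous_system_nontrivial_solution[OF S1.finite_colour_types S2.finite_colour_types less])
  define f where "f c = (\<Sum>T\<in>S2.colour_types N. y T * S2.skew_basis N T c)" for c
  have f: "f \<in> S2.skew_functions N"
    unfolding S2.skew_functions_def f_def
    by (intro CollectI ballI)
      (simp only: S2.skew_functionsD[OF S2.skew_basis_skew] sum_distrib_left mult.left_commute cong: sum.cong)
  have conv: "?conv f c = (\<Sum>T\<in>S2.colour_types N. y T * ?conv (S2.skew_basis N T) c)" for c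
    unfolding f_def sum_distrib_left sum_distrib_right
    by (subst sum.swap) (simp only: mult.assoc)
  have "?conv f c = 0" if "c \<in> \<Omega> \<rightarrow>\<^sub>E {..<N}" for c
    by (rule S1.skew_function_determined_by_representatives[OF two skew[OF f] _ that])
      (use y(2) conv in simp)
  then have zero: "f c = 0" if "c \<in> \<Omega> \<rightarrow>\<^sub>E {..<N}" for c
    using inj[OF f that] by blast
  from y(1) obtain T where T: "T \<in> S2.colour_types N" "y T \<noteq> 0" by blast
  have "f (S2.representative N T) = (\<Sum>T'\<in>S2.colour_types N. if T' = T then y T' else 0)"
    unfolding f_def using T by (intro sum.cong) (auto simp: S2.skew_basis_representative)
  also have "\<dots> = y T" using T S2.finite_colour_types by simp
  finally show False using zero[OF S2.representative(1)[OF T(1)]] T(2) by simp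
qed

section \<open>Signed Young modules\<close>

definition preserves_blocks :: "nat \<Rightarrow> nat list \<Rightarrow> (nat \<Rightarrow> nat) \<Rightarrow> bool" where
  "preserves_blocks k \<mu> \<pi> \<longleftrightarrow> (\<forall>i<length \<mu>. \<pi> ` young_block k \<mu> i = young_block k \<mu> i)"

lemma young_subgroup_altdef:
  "young_subgroup k \<mu> = {\<pi>. \<pi> permutes {k<..k + sum_list \<mu>} \<and> preserves_blocks k \<mu> \<pi>}"
  by (simp add: young_subgroup_def preserves_blocks_def)

lemma young_block_Cons:
  "young_block k (m # \<mu>) 0 = {k<..k + m}" "young_block k (m # \<mu>) (Suc i) = young_block (k + m) \<mu> i"
  by (simp_all add: young_block_def add.assoc)

lemma preserves_blocks_Nil: "preserves_blocks k [] \<pi>"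
  by (simp add: preserves_blocks_def)

lemma preserves_blocks_Cons:
  "preserves_blocks k (m # \<mu>) \<pi> \<longleftrightarrow> \<pi> ` {k<..k + m} = {k<..k + m} \<and> preserves_blocks (k + m) \<mu> \<pi>"
  by (simp add: preserves_blocks_def All_less_Suc2 young_block_Cons)

lemma preserves_blocks_append:
  "preserves_blocks k (\<mu> @ \<nu>) \<pi> \<longleftrightarrow> preserves_blocks k \<mu> \<pi> \<and> preserves_blocks (k + sum_list \<mu>) \<nu> \<pi>"
  by (induction \<mu> arbitrary: k) (simp_all add: preserves_blocks_Nil preserves_blocks_Cons add.assoc)

lemma greaterThanAtMost_add_split: "{k<..k + (m + s :: nat)} = {k<..k + m} \<union> {k + m<..k + m + s}"
  by auto

lemma preserves_blocks_ones: "preserves_blocks k (replicate a 1) \<pi> \<longleftrightarrow> (\<forall>x\<in>{k<..k + a}. \<pi> x = x)"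
proof (induction a arbitrary: k)
  case (Suc a)
  have "{k<..k + 1} = {k + 1}" by auto
  moreover have "{k<..k + Suc a} = insert (k + 1) {k + 1<..k + 1 + a}" by auto
  ultimately show ?case using Suc[of "k + 1"] by (simp add: preserves_blocks_Cons)
qed (simp add: preserves_blocks_Nil)

lemma preserves_blocks_image:
  "preserves_blocks k \<mu> \<pi> \<Longrightarrow> \<pi> ` {k<..k + sum_list \<mu>} = {k<..k + sum_list \<mu>}"
proof (induction \<mu> arbitrary: k)
  case (Cons m \<mu>)
  then have "\<pi> ` {k<..k + m} = {k<..k + m}"
    "\<pi> ` {k + m<..k + m + sum_list \<mu>} = {k + m<..k + m + sum_list \<mu>}"
    by (simp_all add: preserves_blocks_Cons)
  then show ?case by (simp only: sum_list.Cons greaterThanAtMost_add_split image_Un)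
qed simp

lemma preserves_blocks_cong:
  "(\<And>x. x \<in> {k<..k + sum_list \<mu>} \<Longrightarrow> \<pi> x = \<pi>' x) \<Longrightarrow> preserves_blocks k \<mu> \<pi> \<longleftrightarrow> preserves_blocks k \<mu> \<pi>'"
proof (induction \<mu> arbitrary: k)
  case (Cons m \<mu>)
  have "\<pi> ` {k<..k + m} = \<pi>' ` {k<..k + m}" using Cons.prems by (intro image_cong) auto
  moreover have "preserves_blocks (k + m) \<mu> \<pi> \<longleftrightarrow> preserves_blocks (k + m) \<mu> \<pi>'"
    using Cons.prems by (intro Cons.IH) auto
  ultimately show ?case by (simp add: preserves_blocks_Cons)
qed (simp add: preserves_blocks_Nil)

text \<open>
  Both sides consist of the permutations that preserve all blocks of the concatenation: such a
  permutation is the product of its restrictions to the points of \<open>\<alpha>\<close> and to the points of \<open>\<beta>\<close>.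
\<close>

lemma young_subgroup_product:
  "young_subgroup 0 \<alpha> <#>\<^bsub>sym_group n\<^esub> young_subgroup (sum_list \<alpha>) \<beta> = young_subgroup 0 (\<alpha> @ \<beta>)"
proof (intro equalityI subsetI)
  let ?A = "{0<..sum_list \<alpha>}" and ?B = "{sum_list \<alpha><..sum_list \<alpha> + sum_list \<beta>}"
  have AB: "{0<..sum_list \<alpha> + sum_list \<beta>} = ?A \<union> ?B" by auto
  fix \<pi>
  {
    assume "\<pi> \<in> young_subgroup 0 \<alpha> <#>\<^bsub>sym_group n\<^esub> young_subgroup (sum_list \<alpha>) \<beta>"
    then obtain h h' where \<pi>: "\<pi> = h \<circ> h'" and h: "h permutes ?A" "preserves_blocks 0 \<alpha> h"
      and h': "h' permutes ?B" "preserves_blocks (sum_list \<alpha>) \<beta> h'"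
      by (auto simp: set_mult_def sym_group_mult young_subgroup_altdef)
    have "\<pi> permutes {0<..sum_list \<alpha> + sum_list \<beta>}"
      unfolding \<pi> AB using h(1) h'(1) by (meson permutes_compose permutes_subset Un_upper1 Un_upper2)
    moreover have "\<pi> x = h x" if "x \<in> ?A" for x
      using permutes_not_in[OF h'(1), of x] that by (simp add: \<pi>)
    then have "preserves_blocks 0 \<alpha> \<pi>" using h(2) preserves_blocks_cong[of 0 \<alpha> \<pi> h] by simp
    moreover have "\<pi> x = h' x" if "x \<in> ?B" for x
      using permutes_not_in[OF h(1), of "h' x"] permutes_in_image[OF h'(1), of x] that by (simp add: \<pi>)
    then have "preserves_blocks (sum_list \<alpha>) \<beta> \<pi>"
      using h'(2) preserves_blocks_cong[of "sum_list \<alpha>" \<beta> \<pi> h'] by simp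
    ultimately show "\<pi> \<in> young_subgroup 0 (\<alpha> @ \<beta>)"
      by (simp add: young_subgroup_altdef preserves_blocks_append)
  next
    assume "\<pi> \<in> young_subgroup 0 (\<alpha> @ \<beta>)"
    then have \<pi>: "\<pi> permutes ?A \<union> ?B" "preserves_blocks 0 \<alpha> \<pi>" "preserves_blocks (sum_list \<alpha>) \<beta> \<pi>"
      by (simp_all add: young_subgroup_altdef preserves_blocks_append AB)
    have A: "perm_restrict \<pi> ?A permutes ?A" and B: "perm_restrict \<pi> ?B permutes ?B"
      using perm_restrict_permutes[OF \<pi>(1)] preserves_blocks_image[OF \<pi>(2)] preserves_blocks_image[OF \<pi>(3)]
      by simp_all
    have "perm_restrict \<pi> ?A \<circ> perm_restrict \<pi> ?B = perm_restrict \<pi> (?A \<union> ?B)"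
      by (rule perm_restrict_union[OF A B]) auto
    also have "\<dots> = \<pi>" using \<pi>(1) by simp
    finally have "\<pi> = perm_restrict \<pi> ?A \<circ> perm_restrict \<pi> ?B" ..
    moreover have "preserves_blocks 0 \<alpha> (perm_restrict \<pi> ?A)"
      using \<pi>(2) preserves_blocks_cong[of 0 \<alpha> "perm_restrict \<pi> ?A" \<pi>] by (simp add: perm_restrict_def)
    moreover have "preserves_blocks (sum_list \<alpha>) \<beta> (perm_restrict \<pi> ?B)"
      using \<pi>(3) preserves_blocks_cong[of "sum_list \<alpha>" \<beta> "perm_restrict \<pi> ?B" \<pi>] by (simp add: perm_restrict_def)
    ultimately show "\<pi> \<in> young_subgroup 0 \<alpha> <#>\<^bsub>sym_group n\<^esub> young_subgroup (sum_list \<alpha>) \<beta>"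
      using A B by (auto simp: set_mult_def sym_group_mult young_subgroup_altdef)
  }
qed

definition young_sign :: "nat list \<Rightarrow> nat list \<Rightarrow> (nat \<Rightarrow> nat) \<Rightarrow> int" where
  "young_sign \<alpha> \<beta> \<pi> = sign (perm_restrict \<pi> {sum_list \<alpha><..sum_list \<alpha> + sum_list \<beta>})"

lemma signed_young_module_altdef:
  "signed_young_module TYPE('f::field) \<alpha> \<beta> =
     induced_module (sym_group (sum_list \<alpha> + sum_list \<beta>)) (young_subgroup 0 (\<alpha> @ \<beta>))
       (line_module (\<lambda>\<pi>. of_int (young_sign \<alpha> \<beta> \<pi>) :: 'f))"
  by (simp add: signed_young_module_def trivial_sign_module_def Let_def young_subgroup_product young_sign_def)

lemma young_subgroup_subset_sym_group:
  "young_subgroup 0 (\<alpha> @ \<beta>) \<subseteq> carrier (sym_group (sum_list \<alpha> + sum_list \<beta>))"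
proof -
  have "{0<..m} = {1..m::nat}" for m by auto
  then show ?thesis by (auto simp: young_subgroup_altdef sym_group_def)
qed

lemma young_block_append:
  "young_block k (\<mu> @ \<nu>) (length \<mu> + j) = young_block (k + sum_list \<mu>) \<nu> j"
  by (simp add: young_block_def add.assoc)

lemma young_block_cover: "(\<Union>i<length \<mu>. young_block k \<mu> i) = {k<..k + sum_list \<mu>}"
proof (induction \<mu> arbitrary: k)
  case (Cons m \<mu>)
  have "(\<Union>i<length (m # \<mu>). young_block k (m # \<mu>) i) = {k<..k + m} \<union> (\<Union>i<length \<mu>. young_block (k + m) \<mu> i)"
    by (simp only: length_Cons lessThan_Suc_eq_insert_0 UN_insert image_image young_block_Cons)
  then show ?case by (simp only: Cons.IH sum_list.Cons greaterThanAtMost_add_split)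
qed simp

lemma young_block_disjoint: "disjoint_family_on (young_block k \<mu>) S"
proof -
  have "young_block k \<mu> i \<inter> young_block k \<mu> j = {}" if "i < j" for i j
  proof -
    from that obtain d where "j = Suc i + d" using less_iff_Suc_add by auto
    then have "sum_list (take (Suc i) \<mu>) \<le> sum_list (take j \<mu>)" by (simp only: take_add sum_list_append le_add1)
    then show ?thesis by (auto simp: young_block_def)
  qed
  then show ?thesis unfolding disjoint_family_on_def by (metis inf_commute linorder_neqE_nat)
qed

lemma card_young_block: "i < length \<mu> \<Longrightarrow> card (young_block k \<mu> i) = \<mu> ! i"
  by (simp add: young_block_def take_Suc_conv_app_nth)

lemma signed_blocks_young:
  "signed_blocks {0<..sum_list \<alpha> + sum_list \<beta>} {..<length (\<alpha> @ \<beta>)} {length \<alpha>..<length (\<alpha> @ \<beta>)}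
     (young_block 0 (\<alpha> @ \<beta>))"
proof
  show "(\<Union>i<length (\<alpha> @ \<beta>). young_block 0 (\<alpha> @ \<beta>) i) = {0<..sum_list \<alpha> + sum_list \<beta>}"
    by (simp only: young_block_cover sum_list_append add_0)
qed (auto simp: young_block_disjoint)

lemma stabilizer_young:
  "signed_blocks.stabilizer {0<..sum_list \<alpha> + sum_list \<beta>} {..<length (\<alpha> @ \<beta>)} (young_block 0 (\<alpha> @ \<beta>)) =
     young_subgroup 0 (\<alpha> @ \<beta>)"
  by (simp only: signed_blocks.stabilizer_def[OF signed_blocks_young] young_subgroup_def sum_list_append
      add_0 Ball_def lessThan_iff)

lemma block_sign_young:
  "signed_blocks.block_sign {length \<alpha>..<length (\<alpha> @ \<beta>)} (young_block 0 (\<alpha> @ \<beta>)) = young_sign \<alpha> \<beta>"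
proof -
  have "{length \<alpha>..<length (\<alpha> @ \<beta>)} = (+) (length \<alpha>) ` {..<length \<beta>}"
    by (simp add: lessThan_atLeast0 add.commute)
  then have "(\<Union>i\<in>{length \<alpha>..<length (\<alpha> @ \<beta>)}. young_block 0 (\<alpha> @ \<beta>) i)
      = (\<Union>j<length \<beta>. young_block (sum_list \<alpha>) \<beta> j)"
    by (simp only: image_image young_block_append add_0)
  then show ?thesis
    by (simp only: fun_eq_iff signed_blocks.block_sign_def[OF signed_blocks_young[of \<alpha> \<beta>]]
        signed_blocks.signed_points_def[OF signed_blocks_young[of \<alpha> \<beta>]] young_block_cover young_sign_def
        simp_thms)
qed

lemma card_colour_types_young:
  "card (signed_blocks.colour_types {..<length (\<alpha> @ \<beta>)} {length \<alpha>..<length (\<alpha> @ \<beta>)} (young_block 0 (\<alpha> @ \<beta>)) N)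
    = colour_count \<alpha> \<beta> N"
proof -
  have split: "(\<Prod>i<a + b. g i) = (\<Prod>i<a. g i) * (\<Prod>j<b. g (a + j))" for g :: "nat \<Rightarrow> nat" and a b
    by (induction b) (simp_all add: mult.assoc)
  let ?g = "\<lambda>i. if i \<in> {length \<alpha>..<length (\<alpha> @ \<beta>)} then N choose ((\<alpha> @ \<beta>) ! i)
    else ((\<alpha> @ \<beta>) ! i + N - 1) choose ((\<alpha> @ \<beta>) ! i)"
  have "card (signed_blocks.colour_types {..<length (\<alpha> @ \<beta>)} {length \<alpha>..<length (\<alpha> @ \<beta>)} (young_block 0 (\<alpha> @ \<beta>)) N)
    = (\<Prod>i<length (\<alpha> @ \<beta>). ?g i)"
    unfolding signed_blocks.card_colour_types[OF signed_blocks_young]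
    by (intro prod.cong) (simp_all only: card_young_block lessThan_iff)
  also have "\<dots> = (\<Prod>i<length \<alpha>. ?g i) * (\<Prod>j<length \<beta>. ?g (length \<alpha> + j))"
    unfolding length_append by (rule split)
  also have "(\<Prod>i<length \<alpha>. ?g i) = (\<Prod>k\<leftarrow>\<alpha>. (k + N - 1) choose k)"
    by (simp add: prod.list_conv_set_nth lessThan_atLeast0 nth_append)
  also have "(\<Prod>j<length \<beta>. ?g (length \<alpha> + j)) = (\<Prod>k\<leftarrow>\<beta>. N choose k)"
    by (simp add: prod.list_conv_set_nth lessThan_atLeast0)
  finally show ?thesis by (simp add: colour_count_def)
qed

text \<open>
  For a skew function \<open>f\<close> of \<open>(\<sigma>|\<tau>)\<close> and a colouring \<open>c\<close>, the function \<open>g \<mapsto> f (c \<circ> g)\<close> on the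
  symmetric group is equivariant, so convolution by the element \<open>u\<close> of the isomorphism applies to \<open>f\<close>.
\<close>

lemma signed_young_module_iso_imp_colour_count_le:
  assumes two: "(2 :: 'f::field) \<noteq> 0"
    and n: "sum_list \<alpha> + sum_list \<beta> = n" "sum_list \<sigma> + sum_list \<tau> = n"
    and iso: "group_module_isomorphic (sym_group n)
      (signed_young_module TYPE('f) \<alpha> \<beta>) (signed_young_module TYPE('f) \<sigma> \<tau>)"
  shows "colour_count \<sigma> \<tau> N \<le> colour_count \<alpha> \<beta> N"
proof -
  let ?\<Omega> = "{0<..n}"
  let ?K1 = "young_subgroup 0 (\<alpha> @ \<beta>)" and ?K2 = "young_subgroup 0 (\<sigma> @ \<tau>)"
  let ?\<chi>1 = "\<lambda>\<pi>. of_int (young_sign \<alpha> \<beta> \<pi>) :: 'f" and ?\<chi>2 = "\<lambda>\<pi>. of_int (young_sign \<sigma> \<tau> \<pi>) :: 'f"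
  let ?I1 = "{..<length (\<alpha> @ \<beta>)}" and ?J1 = "{length \<alpha>..<length (\<alpha> @ \<beta>)}" and ?P1 = "young_block 0 (\<alpha> @ \<beta>)"
  let ?I2 = "{..<length (\<sigma> @ \<tau>)}" and ?J2 = "{length \<sigma>..<length (\<sigma> @ \<tau>)}" and ?P2 = "young_block 0 (\<sigma> @ \<tau>)"
  have S1: "signed_blocks ?\<Omega> ?I1 ?J1 ?P1" using signed_blocks_young[of \<alpha> \<beta>] by (simp only: n)
  have S2: "signed_blocks ?\<Omega> ?I2 ?J2 ?P2" using signed_blocks_young[of \<sigma> \<tau>] by (simp only: n)
  interpret S1: signed_blocks ?\<Omega> ?I1 ?J1 ?P1 by (rule S1)
  interpret S2: signed_blocks ?\<Omega> ?I2 ?J2 ?P2 by (rule S2)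
  interpret group "sym_group n" by (rule sym_group_is_group)
  have stab: "S1.stabilizer = ?K1" "S2.stabilizer = ?K2"
    using stabilizer_young[of \<alpha> \<beta>] stabilizer_young[of \<sigma> \<tau>] by (simp_all only: n)
  have sgn: "S1.block_sign = young_sign \<alpha> \<beta>" "S2.block_sign = young_sign \<sigma> \<tau>"
    by (rule block_sign_young)+
  have \<Omega>: "{1..n} = ?\<Omega>" by auto
  have carrier: "carrier (sym_group n) = {x. x permutes ?\<Omega>}" by (simp only: sym_group_def \<Omega> partial_object.simps)
  have fin: "finite (carrier (sym_group n))" by (simp add: carrier finite_permutations)
  have K1: "?K1 \<subseteq> carrier (sym_group n)" and K2: "?K2 \<subseteq> carrier (sym_group n)"
    using young_subgroup_subset_sym_group[of \<alpha> \<beta>] young_subgroup_subset_sym_group[of \<sigma> \<tau>] by (simp_all only: n)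
  have iso': "group_module_isomorphic (sym_group n)
      (induced_module (sym_group n) ?K1 (line_module ?\<chi>1)) (induced_module (sym_group n) ?K2 (line_module ?\<chi>2))"
    using iso by (simp only: signed_young_module_altdef n)
  obtain u :: "(nat \<Rightarrow> nat) \<Rightarrow> 'f" where
    "\<forall>k. equivariant (sym_group n) ?K2 ?\<chi>2 k \<longrightarrow> (\<forall>h\<in>?K1.
       (\<Sum>x\<in>carrier (sym_group n). k (h \<otimes>\<^bsub>sym_group n\<^esub> x) * u x) =
         ?\<chi>1 h * (\<Sum>x\<in>carrier (sym_group n). k x * u x))"
    "\<forall>k. equivariant (sym_group n) ?K2 ?\<chi>2 k \<longrightarrow>
       (\<forall>g\<in>carrier (sym_group n).
         (\<Sum>x\<in>carrier (sym_group n). k (g \<otimes>\<^bsub>sym_group n\<^esub> x) * u x) = 0) \<longrightarrow>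
       k \<one>\<^bsub>sym_group n\<^esub> = 0"
    by (rule induced_line_module_iso_imp_convolution[OF fin K1 K2 iso'])
  note u = this[unfolded carrier sym_group_mult sym_group_one, rule_format, unfolded mem_Collect_eq]
  have equi: "equivariant (sym_group n) ?K2 ?\<chi>2 (\<lambda>g. f (c \<circ> g))"
    if "f \<in> S2.skew_functions N" "c \<in> ?\<Omega> \<rightarrow>\<^sub>E {..<N}" for f c
    unfolding equivariant_def sym_group_mult comp_assoc[symmetric]
  proof (intro ballI)
    fix g h assume g: "g \<in> carrier (sym_group n)" and h: "h \<in> ?K2"
    have "c \<circ> g \<in> ?\<Omega> \<rightarrow>\<^sub>E {..<N}"
      using g by (intro S2.comp_permutes_in_colourings that(2)) (simp only: carrier mem_Collect_eq)
    from S2.skew_functionsD[OF that(1) this, of h] h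
    show "f (c \<circ> g \<circ> h) = ?\<chi>2 h * f (c \<circ> g)" by (simp only: stab sgn)
  qed
  have "card (S2.colour_types N) \<le> card (S1.colour_types N)"
  proof (rule colour_types_card_mono[OF S1 S2 two, where u = u])
    fix f :: "(nat \<Rightarrow> nat) \<Rightarrow> 'f" assume f: "f \<in> S2.skew_functions N"
    show "(\<lambda>c. \<Sum>x | x permutes ?\<Omega>. f (c \<circ> x) * u x) \<in> S1.skew_functions N"
      unfolding S1.skew_functions_def stab sgn
      by (intro CollectI ballI) (simp only: comp_assoc u(1)[OF equi[OF f]])
    fix c assume c: "c \<in> ?\<Omega> \<rightarrow>\<^sub>E {..<N}"
      and zero: "\<And>c. c \<in> ?\<Omega> \<rightarrow>\<^sub>E {..<N} \<Longrightarrow> (\<Sum>x | x permutes ?\<Omega>. f (c \<circ> x) * u x) = 0"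
    have "f (c \<circ> id) = 0"
      using zero[OF S2.comp_permutes_in_colourings[OF _ c]]
      by (intro u(2)[OF equi[OF f c]]) (simp only: comp_assoc)
    then show "f c = 0" by simp
  qed
  then show ?thesis by (simp only: card_colour_types_young)
qed

text \<open>
  Blocks of size \<open>1\<close> only force their points to be fixed, so the group is governed by \<open>\<rho>\<close>, by \<open>\<zeta>\<close>
  and by the offset \<open>sum_list \<rho> + a\<close> at which the blocks of \<open>\<zeta>\<close> start.
\<close>

lemma young_subgroup_with_ones:
  "young_subgroup 0 ((\<rho> @ replicate a 1) @ (\<zeta> @ replicate c 1)) =
     {h. h permutes {0<..sum_list \<rho> + a + sum_list \<zeta> + c} \<and> preserves_blocks 0 \<rho> h
       \<and> preserves_blocks (sum_list \<rho> + a) \<zeta> h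
       \<and> (\<forall>x. x \<notin> {0<..sum_list \<rho>} \<union> {sum_list \<rho> + a<..sum_list \<rho> + a + sum_list \<zeta>} \<longrightarrow> h x = x)}"
  (is "_ = ?R")
proof (intro equalityI subsetI)
  let ?r = "sum_list \<rho>" and ?z = "sum_list \<zeta>"
  fix h
  have iff: "h \<in> young_subgroup 0 ((\<rho> @ replicate a 1) @ (\<zeta> @ replicate c 1)) \<longleftrightarrow>
      h permutes {0<..?r + a + ?z + c} \<and> preserves_blocks 0 \<rho> h \<and> (\<forall>x\<in>{?r<..?r + a}. h x = x)
      \<and> preserves_blocks (?r + a) \<zeta> h \<and> (\<forall>x\<in>{?r + a + ?z<..?r + a + ?z + c}. h x = x)"
    by (simp add: young_subgroup_altdef preserves_blocks_append preserves_blocks_ones[simplified]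
        sum_list_replicate add.assoc conj_ac)
  show "h \<in> ?R" if "h \<in> young_subgroup 0 ((\<rho> @ replicate a 1) @ (\<zeta> @ replicate c 1))"
  proof -
    have "h x = x" if x: "x \<notin> {0<..?r} \<union> {?r + a<..?r + a + ?z}" for x
    proof (cases "x \<in> {0<..?r + a + ?z + c}")
      case True
      then have "x \<in> {?r<..?r + a} \<or> x \<in> {?r + a + ?z<..?r + a + ?z + c}" using x by auto
      then show ?thesis using that iff \<open>h \<in> young_subgroup 0 _\<close> by blast
    next
      case False
      then show ?thesis using iff \<open>h \<in> young_subgroup 0 _\<close> permutes_not_in by metis
    qed
    then show ?thesis using that iff by simp
  qed
  show "h \<in> young_subgroup 0 ((\<rho> @ replicate a 1) @ (\<zeta> @ replicate c 1))" if "h \<in> ?R"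
    unfolding iff using that by auto
qed

lemma preserves_blocks_conj:
  assumes t: "bij t" and shift: "\<And>x. x \<in> {0<..sum_list \<mu>} \<Longrightarrow> t (k + x) = k' + x"
    and h: "preserves_blocks k' \<mu> h"
  shows "preserves_blocks k \<mu> (inv' t \<circ> h \<circ> t)"
  unfolding preserves_blocks_def
proof (intro allI impI)
  fix i assume i: "i < length \<mu>"
  have shifted: "young_block j \<mu> i = (+) j ` young_block 0 \<mu> i" for j
    by (simp add: young_block_def add.assoc)
  have "young_block 0 \<mu> i \<subseteq> {0<..sum_list \<mu>}" using young_block_cover[of 0 \<mu>] i by auto
  then have tb: "t ` young_block k \<mu> i = young_block k' \<mu> i"
    unfolding shifted[of k] shifted[of k'] image_image using shift by (intro image_cong) auto
  then have "inv' t ` young_block k' \<mu> i = young_block k \<mu> i"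
    using t by (metis bij_is_inj image_inv_f_f)
  moreover have "h ` young_block k' \<mu> i = young_block k' \<mu> i" using h i by (simp add: preserves_blocks_def)
  ultimately show "(inv' t \<circ> h \<circ> t) ` young_block k \<mu> i = young_block k \<mu> i"
    by (simp only: image_comp[symmetric] tb)
qed

lemma sign_perm_restrict_conj:
  assumes t: "t permutes \<Omega>" and h: "h permutes \<Omega>" and fin: "finite \<Omega>" and S: "h ` (t ` S) = t ` S"
    "t ` S \<subseteq> \<Omega>"
  shows "sign (perm_restrict (inv' t \<circ> h \<circ> t) S) = sign (perm_restrict h (t ` S))"
proof -
  have "perm_restrict (inv' t \<circ> h \<circ> t) S = inv' t \<circ> perm_restrict h (t ` S) \<circ> t"
  proof
    fix x have "t x \<in> t ` S \<longleftrightarrow> x \<in> S" using permutes_inj[OF t] by (simp add: inj_image_mem_iff)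
    then show "perm_restrict (inv' t \<circ> h \<circ> t) S x = (inv' t \<circ> perm_restrict h (t ` S) \<circ> t) x"
      using permutes_inverses(2)[OF t] by (simp add: perm_restrict_def)
  qed
  moreover have "perm_restrict h (t ` S) permutes t ` S" by (rule perm_restrict_permutes[OF h S(1)])
  then have "permutation (perm_restrict h (t ` S))"
    using finite_subset[OF S(2) fin] permutes_imp_permutation by blast
  moreover have "permutation t" "permutation (inv' t)"
    using t permutes_inv[OF t] fin permutes_imp_permutation by blast+
  ultimately show ?thesis by (simp add: sign_compose sign_inverse permutation_compose)
qed

text \<open>
  The permutation \<open>t\<close> moves the blocks of \<open>\<zeta>\<close> from offset \<open>sum_list \<rho> + b\<close> to offset
  \<open>sum_list \<rho> + a\<close>. The points in blocks of size \<open>1\<close> are fixed, so they do not change the sign, on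
  whichever side they are counted.
\<close>

lemma conj_young_subgroup_with_ones:
  assumes t: "t permutes {0<..sum_list \<rho> + a + sum_list \<zeta> + c}" and size: "a + c = b + d"
    and t_\<rho>: "\<And>x. x \<in> {0<..sum_list \<rho>} \<Longrightarrow> t x = x"
    and t_\<zeta>: "\<And>x. x \<in> {0<..sum_list \<zeta>} \<Longrightarrow> t (sum_list \<rho> + b + x) = sum_list \<rho> + a + x"
    and h: "h \<in> young_subgroup 0 ((\<rho> @ replicate a 1) @ (\<zeta> @ replicate c 1))"
  shows "inv' t \<circ> h \<circ> t \<in> young_subgroup 0 ((\<rho> @ replicate b 1) @ (\<zeta> @ replicate d 1))"
    and "young_sign (\<rho> @ replicate b 1) (\<zeta> @ replicate d 1) (inv' t \<circ> h \<circ> t) =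
      young_sign (\<rho> @ replicate a 1) (\<zeta> @ replicate c 1) h"
proof -
  let ?r = "sum_list \<rho>" and ?z = "sum_list \<zeta>"
  let ?\<Omega> = "{0<..?r + a + ?z + c}"
  have \<Omega>: "?\<Omega> = {0<..?r + b + ?z + d}" using size by auto
  let ?Sa = "{?r + a<..?r + a + ?z}" and ?Sb = "{?r + b<..?r + b + ?z}"
  have bij: "bij t" using t by (rule permutes_bij)
  have h': "h permutes ?\<Omega>" "preserves_blocks 0 \<rho> h" "preserves_blocks (?r + a) \<zeta> h"
    and fix_h: "\<And>x. x \<notin> {0<..?r} \<union> ?Sa \<Longrightarrow> h x = x"
    using h unfolding young_subgroup_with_ones by blast+
  have S: "{?r + k<..?r + k + ?z} = (+) (?r + k) ` {0<..?z}" for k by simp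
  have tS: "t ` ?Sb = ?Sa"
    unfolding S image_image using t_\<zeta> by (intro image_cong) auto
  have t0: "t ` {0<..?r} = {0<..?r}" using t_\<rho> by simp
  have fixed: "(inv' t \<circ> h \<circ> t) x = x" if "x \<notin> {0<..?r} \<union> ?Sb" for x
  proof -
    have "t x \<notin> t ` ({0<..?r} \<union> ?Sb)" using that permutes_inj[OF t] by (simp add: inj_image_mem_iff)
    then have "h (t x) = t x" by (intro fix_h) (simp only: image_Un tS t0 not_False_eq_True)
    then show ?thesis using permutes_inverses(2)[OF t] by simp
  qed
  have perm: "inv' t \<circ> h \<circ> t permutes ?\<Omega>"
    using permutes_compose[OF t permutes_compose[OF h'(1) permutes_inv[OF t]]] by (simp only: comp_assoc)
  show "inv' t \<circ> h \<circ> t \<in> young_subgroup 0 ((\<rho> @ replicate b 1) @ (\<zeta> @ replicate d 1))"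
    unfolding young_subgroup_with_ones
    using perm[unfolded \<Omega>] fixed preserves_blocks_conj[OF bij _ h'(2), of 0] t_\<rho>
      preserves_blocks_conj[OF bij _ h'(3), of "?r + b"] t_\<zeta> by simp
  \<comment> \<open>The sign is taken over all points of the second partition; those in blocks of size \<open>1\<close> can be
    left out.\<close>
  have trim: "perm_restrict g {?r + k<..?r + k + ?z + l} = perm_restrict g {?r + k<..?r + k + ?z}"
    if "\<And>x. x \<notin> {0<..?r} \<union> {?r + k<..?r + k + ?z} \<Longrightarrow> g x = x" for g k l
    using that by (auto simp: perm_restrict_def fun_eq_iff)
  have "young_sign (\<rho> @ replicate b 1) (\<zeta> @ replicate d 1) (inv' t \<circ> h \<circ> t)
      = sign (perm_restrict (inv' t \<circ> h \<circ> t) {?r + b<..?r + b + ?z + d})"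
    by (simp add: young_sign_def sum_list_replicate add.assoc)
  also have "\<dots> = sign (perm_restrict (inv' t \<circ> h \<circ> t) ?Sb)"
    by (rule arg_cong[where f = sign], rule trim, rule fixed)
  also have "\<dots> = sign (perm_restrict h ?Sa)"
    unfolding tS[symmetric]
    by (rule sign_perm_restrict_conj[OF t h'(1)]) (use tS preserves_blocks_image[OF h'(3)] in auto)
  also have "\<dots> = sign (perm_restrict h {?r + a<..?r + a + ?z + c})"
    by (rule sym, rule arg_cong[where f = sign], rule trim, rule fix_h)
  also have "\<dots> = young_sign (\<rho> @ replicate a 1) (\<zeta> @ replicate c 1) h"
    by (simp add: young_sign_def sum_list_replicate add.assoc)
  finally show "young_sign (\<rho> @ replicate b 1) (\<zeta> @ replicate d 1) (inv' t \<circ> h \<circ> t) =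
      young_sign (\<rho> @ replicate a 1) (\<zeta> @ replicate c 1) h" .
qed

lemma exists_permutation_shifting_interval:
  fixes r a z c b d :: nat
  assumes size: "a + c = b + d"
  obtains t where "t permutes {0<..r + a + z + c}" "\<And>x. x \<in> {0<..r} \<Longrightarrow> t x = x"
    "\<And>x. x \<in> {0<..z} \<Longrightarrow> t (r + b + x) = r + a + x"
proof -
  let ?\<Omega> = "{0<..r + a + z + c}"
  let ?Sa = "{0<..r} \<union> {r + a<..r + a + z}" and ?Sb = "{0<..r} \<union> {r + b<..r + b + z}"
  \<comment> \<open>On the second interval of \<open>?Sb\<close> the subtraction is not truncated, because \<open>x > r + b\<close>.\<close>
  define s where "s x = (if x \<le> r then x else x + a - b)" for x
  have s: "bij_betw s ?Sb ?Sa"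
    by (rule bij_betw_byWitness[where f' = "\<lambda>x. if x \<le> r then x else x + b - a"]) (auto simp: s_def)
  have sub: "?Sa \<subseteq> ?\<Omega>" "?Sb \<subseteq> ?\<Omega>" using size by auto
  have "card ?Sb = card ?Sa" using s by (rule bij_betw_same_card)
  then have "card (?\<Omega> - ?Sb) = card (?\<Omega> - ?Sa)" using sub by (simp add: card_Diff_subset)
  then obtain s' where s': "bij_betw s' (?\<Omega> - ?Sb) (?\<Omega> - ?Sa)"
    using finite_same_card_bij[of "?\<Omega> - ?Sb" "?\<Omega> - ?Sa"] by auto
  define t where "t x = (if x \<in> ?Sb then s x else if x \<in> ?\<Omega> then s' x else x)" for x
  have "bij_betw t ?Sb ?Sa" using s by (rule bij_betw_cong[THEN iffD1, rotated]) (simp only: t_def if_True)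
  moreover have "bij_betw t (?\<Omega> - ?Sb) (?\<Omega> - ?Sa)"
    using s'
  proof (rule bij_betw_cong[THEN iffD1, rotated])
    show "s' x = t x" if "x \<in> ?\<Omega> - ?Sb" for x
      using that unfolding t_def by (elim DiffE) (simp only: if_True if_False)
  qed
  ultimately have "bij_betw t (?Sb \<union> (?\<Omega> - ?Sb)) (?Sa \<union> (?\<Omega> - ?Sa))"
    by (rule bij_betw_combine) blast
  then have "bij_betw t ?\<Omega> ?\<Omega>" using sub by (simp only: Un_Diff_cancel Un_absorb1)
  then have "t permutes ?\<Omega>" by (rule bij_imp_permutes) (use sub in \<open>auto simp: t_def\<close>)
  moreover have "t x = x" if "x \<in> {0<..r}" for x using that by (simp add: t_def s_def)
  moreover have "t (r + b + x) = r + a + x" if "x \<in> {0<..z}" for x using that by (simp add: t_def s_def)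
  ultimately show thesis by (rule that)
qed

lemma signed_young_modules_with_moved_ones_isomorphic:
  assumes size: "a + c = b + d" and n: "n = sum_list \<rho> + a + sum_list \<zeta> + c"
  shows "group_module_isomorphic (sym_group n)
    (signed_young_module TYPE('f::field) (\<rho> @ replicate a 1) (\<zeta> @ replicate c 1))
    (signed_young_module TYPE('f) (\<rho> @ replicate b 1) (\<zeta> @ replicate d 1))"
proof -
  interpret group "sym_group n" by (rule sym_group_is_group)
  let ?r = "sum_list \<rho>" and ?z = "sum_list \<zeta>"
  let ?\<alpha> = "\<rho> @ replicate a 1" and ?\<beta> = "\<zeta> @ replicate c 1" and ?\<sigma> = "\<rho> @ replicate b 1" and ?\<tau> = "\<zeta> @ replicate d 1"
  have n1: "sum_list ?\<alpha> + sum_list ?\<beta> = n" and n2: "sum_list ?\<sigma> + sum_list ?\<tau> = n"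
    using size by (simp_all add: n sum_list_replicate)
  obtain t where t: "t permutes {0<..?r + a + ?z + c}"
    and t_\<rho>: "\<And>x. x \<in> {0<..?r} \<Longrightarrow> t x = x"
    and t_\<zeta>: "\<And>x. x \<in> {0<..?z} \<Longrightarrow> t (?r + b + x) = ?r + a + x"
    using exists_permutation_shifting_interval[OF size] by metis
  have \<Omega>: "{0<..?r + a + ?z + c} = {1..n}" by (auto simp: n)
  have \<Omega>': "{0<..?r + a + ?z + c} = {0<..?r + b + ?z + d}" using size by auto
  have tG: "t \<in> carrier (sym_group n)" using t by (simp only: sym_group_carrier \<Omega>)
  have inv_t: "inv\<^bsub>sym_group n\<^esub> t = inv' t" using tG by simp
  have inv_inv: "inv' (inv' t) = t" using t by (simp add: inv_inv_eq permutes_bij)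
  note inverses = permutes_inverses(2)[OF t]
  have ti: "inv' t permutes {0<..?r + b + ?z + d}" using permutes_inv[OF t] by (simp only: \<Omega>')
  have ti_\<rho>: "inv' t x = x" if "x \<in> {0<..?r}" for x using inverses[of x] t_\<rho>[OF that] by simp
  have ti_\<zeta>: "inv' t (?r + a + x) = ?r + b + x" if "x \<in> {0<..?z}" for x
    using inverses[of "?r + b + x"] t_\<zeta>[OF that] by simp
  note conj = conj_young_subgroup_with_ones[OF t size t_\<rho> t_\<zeta>]
  have conj': "t \<circ> h \<circ> inv' t \<in> young_subgroup 0 (?\<alpha> @ ?\<beta>)" if "h \<in> young_subgroup 0 (?\<sigma> @ ?\<tau>)" for h
    using conj_young_subgroup_with_ones(1)[OF ti size[symmetric] ti_\<rho> ti_\<zeta> that] by (simp only: inv_inv)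
  show ?thesis
    unfolding signed_young_module_altdef n1 n2
  proof (rule conjugate_induced_line_modules_isomorphic[OF tG])
    show "young_subgroup 0 (?\<alpha> @ ?\<beta>) \<subseteq> carrier (sym_group n)"
      using young_subgroup_subset_sym_group[of ?\<alpha> ?\<beta>] by (simp only: n1)
    show "young_subgroup 0 (?\<sigma> @ ?\<tau>) \<subseteq> carrier (sym_group n)"
      using young_subgroup_subset_sym_group[of ?\<sigma> ?\<tau>] by (simp only: n2)
  qed (simp_all only: sym_group_mult inv_t conj conj' simp_thms)
qed

theorem theorem6p1:
  fixes p n :: nat and \<alpha> \<beta> \<sigma> \<tau> :: "nat list"
  assumes "prime p" and "odd p"
    and "CHAR('f::field) = p"
    and "is_partition \<alpha>" and "is_partition \<beta>" and "is_partition \<sigma>" and "is_partition \<tau>"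
    and "sum_list \<alpha> + sum_list \<beta> = n" and "sum_list \<sigma> + sum_list \<tau> = n"
  shows "group_module_isomorphic (sym_group n)
           (signed_young_module TYPE('f) \<alpha> \<beta>) (signed_young_module TYPE('f) \<sigma> \<tau>)
         \<longleftrightarrow> (\<exists>a b c d \<rho> \<zeta>. is_partition \<rho> \<and> is_partition \<zeta> \<and>
               \<alpha> = \<rho> @ replicate a 1 \<and> \<sigma> = \<rho> @ replicate b 1 \<and>
               \<beta> = \<zeta> @ replicate c 1 \<and> \<tau> = \<zeta> @ replicate d 1)"
    (is "?iso \<longleftrightarrow> ?combinatorial")
proof
  assume iso: ?iso
  have "\<not> p dvd 2"
    using \<open>prime p\<close> \<open>odd p\<close> by (metis dvd_refl primes_dvd_imp_eq two_is_prime_nat)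
  then have two: "(2 :: 'f) \<noteq> 0"
    using \<open>CHAR('f) = p\<close> of_nat_eq_0_iff_char_dvd[where 'a = 'f, of 2] by simp
  interpret group "sym_group n" by (rule sym_group_is_group)
  have K: "young_subgroup 0 (\<alpha> @ \<beta>) \<subseteq> carrier (sym_group n)"
    using young_subgroup_subset_sym_group[of \<alpha> \<beta>] assms(8) by simp
  have iso': "group_module_isomorphic (sym_group n)
      (signed_young_module TYPE('f) \<sigma> \<tau>) (signed_young_module TYPE('f) \<alpha> \<beta>)"
    using iso unfolding signed_young_module_altdef assms(8,9)
    by (rule induced_line_module_isomorphic_sym[OF K])
  have count: "colour_count \<alpha> \<beta> N = colour_count \<sigma> \<tau> N" for N
    using signed_young_module_iso_imp_colour_count_le[OF two assms(8,9) iso]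
      signed_young_module_iso_imp_colour_count_le[OF two assms(9,8) iso'] by (intro antisym)
  obtain \<rho> a b where \<rho>: "is_partition \<rho>" "\<alpha> = \<rho> @ replicate a 1" "\<sigma> = \<rho> @ replicate b 1"
    using partitions_with_equal_long_parts[OF assms(4,6) colour_count_determines_long_parts(1)[OF count]]
    by blast
  obtain \<zeta> c d where \<zeta>: "is_partition \<zeta>" "\<beta> = \<zeta> @ replicate c 1" "\<tau> = \<zeta> @ replicate d 1"
    using partitions_with_equal_long_parts[OF assms(5,7) colour_count_determines_long_parts(2)[OF count]]
    by blast
  show ?combinatorial using \<rho> \<zeta> by blast
next
  assume ?combinatorial
  then obtain a b c d \<rho> \<zeta> where eqs: "\<alpha> = \<rho> @ replicate a 1" "\<sigma> = \<rho> @ replicate b 1"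
    "\<beta> = \<zeta> @ replicate c 1" "\<tau> = \<zeta> @ replicate d 1" by blast
  have "a + c = b + d" "n = sum_list \<rho> + a + sum_list \<zeta> + c"
    using assms(8,9) by (simp_all add: eqs sum_list_replicate)
  then show ?iso unfolding eqs by (rule signed_young_modules_with_moved_ones_isomorphic)
qed

end
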